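(* Let $\mathbb{Q}^{\mathrm{rc}}$ denote the field of real algebraic numbers and $\mathrm{PSF}(\mathbb{Q}^{\mathrm{rc}})$ the Puiseux series field over $\mathbb{Q}^{\mathrm{rc}}$, which is a real closed field. If $I$ is any integer part of $\mathrm{PSF}(\mathbb{Q}^{\mathrm{rc}})$, then its quotient field $\mathrm{Quot}\, I$ is a proper countable subfield of $\mathrm{PSF}(\mathbb{Q}^{\mathrm{rc}})$, and the transcendence degree of $\mathrm{PSF}(\mathbb{Q}^{\mathrm{rc}})$ over $\mathrm{Quot}\, I$ is uncountable. The same holds with $\mathrm{PSF}(\mathbb{Q}^{\mathrm{rc}})$ replaced by its completion.
   Context: For a field $k$, the Puiseux series field over $k$ is $\mathrm{PSF}(k):=\bigcup_{n\in\mathbb{N}} k((t^{1/n}))$, a subfield of the power series field $k((t^{\mathbb{Q}}))$ with coefficients in $k$ and exponents in $\mathbb{Q}$, equipped with the canonical ($t$-adic, lowest exponent) valuation; completion refers to this valuation and may be taken inside $k((t^{\mathbb{Q}}))$. For $k=\mathbb{Q}^{\mathrm{rc}}$, the real closed field $\mathrm{PSF}(k)$ carries its unique ordering (the sign of a nonzero series is the sign of its lowest-exponent coefficient), and its completion is ordered in the same way. An integer part of an ordered field $K$ is a discretely ordered subring $I$ containing $1$ such that for all $a\in K$ there is $r\in I$ with $r\leq a<r+1$ (it follows that $1$ is the least positive element of $I$). *)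

theory Defs
  imports
    Complex_Main
    "HOL-Library.Countable_Set"
    "HOL-Library.Poly_Mapping"
    "HOL-Computational_Algebra.Polynomial"
begin

lemma wo_iff_least:
  fixes A :: "'a::linorder set"
  shows "wfp_on A (<) \<longleftrightarrow> (\<forall>S\<subseteq>A. S \<noteq> {} \<longrightarrow> (\<exists>m\<in>S. \<forall>x\<in>S. m \<le> x))"
  unfolding wfp_on_iff_ex_minimal by (meson leD not_le)

lemma wo_no_descent:
  fixes A :: "'a::linorder set"
  assumes "wfp_on A (<)" "\<And>n. s n \<in> A" "\<And>n. s (Suc n) < s n"
  shows False
proof -
  obtain m where "m \<in> range s" "\<forall>x\<in>range s. m \<le> x"
    using assms(1)[unfolded wo_iff_least, rule_format, of "range s"] assms(2) by auto
  then obtain n where "\<forall>k. s n \<le> s k" by auto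
  with assms(3)[of n] show False by (meson leD)
qed

lemma wo_if_no_descent:
  fixes A :: "'a::linorder set"
  assumes "\<And>s :: nat \<Rightarrow> 'a. (\<And>n. s n \<in> A) \<Longrightarrow> (\<And>n. s (Suc n) < s n) \<Longrightarrow> False"
  shows "wfp_on A (<)"
proof (rule ccontr)
  assume "\<not> wfp_on A (<)"
  then obtain S where S: "S \<subseteq> A" "S \<noteq> {}" "\<And>m. m \<in> S \<Longrightarrow> \<exists>x\<in>S. x < m"
    unfolding wo_iff_least by (meson not_le)
  obtain s :: "nat \<Rightarrow> 'a" where "\<forall>n. s n \<in> S \<and> s (Suc n) < s n"
    using dependent_nat_choice[of "\<lambda>_ x. x \<in> S" "\<lambda>_ x y. y < x"] S(2,3)
    by (metis all_not_in_conv)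
  then show False using assms[of s] S(1) by auto
qed

lemma wo_finite: "finite A \<Longrightarrow> wfp_on (A :: 'a::linorder set) (<)"
  unfolding wo_iff_least by (metis Min_in Min_le finite_subset)

lemma wo_Un:
  fixes A :: "'a::linorder set"
  assumes "wfp_on A (<)" "wfp_on B (<)"
  shows "wfp_on (A \<union> B) (<)"
  unfolding wo_iff_least
proof (intro allI impI)
  fix S assume S: "S \<subseteq> A \<union> B" "S \<noteq> {}"
  have 1: "S \<inter> A = {} \<or> (\<exists>m\<in>S \<inter> A. \<forall>x\<in>S \<inter> A. m \<le> x)"
    using assms(1)[unfolded wo_iff_least] by (meson inf_le2)
  have 2: "S \<inter> B = {} \<or> (\<exists>m\<in>S \<inter> B. \<forall>x\<in>S \<inter> B. m \<le> x)"
    using assms(2)[unfolded wo_iff_least] by (meson inf_le2)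
  show "\<exists>m\<in>S. \<forall>x\<in>S. m \<le> x"
  proof (cases "S \<inter> A = {}")
    case True
    with 2 S show ?thesis by blast
  next
    case False
    with 1 obtain a where a: "a \<in> S" "\<forall>x\<in>S \<inter> A. a \<le> x" by blast
    show ?thesis
    proof (cases "S \<inter> B = {}")
      case True
      with a S show ?thesis by blast
    next
      case False
      with 2 obtain b where b: "b \<in> S" "\<forall>x\<in>S \<inter> B. b \<le> x" by blast
      have "min a b \<in> S" using a b by (auto simp: min_def)
      moreover have "\<forall>x\<in>S. min a b \<le> x" using a b S(1) by (auto simp: min_le_iff_disj)
      ultimately show ?thesis by blast
    qed
  qed
qed

lemma wo_sum:
  fixes A B :: "rat set"
  assumes "wfp_on A (<)" "wfp_on B (<)"
  shows "wfp_on {a + b |a b. a \<in> A \<and> b \<in> B} (<)"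
proof (rule wo_if_no_descent)
  fix s :: "nat \<Rightarrow> rat"
  assume "\<And>n. s n \<in> {a + b |a b. a \<in> A \<and> b \<in> B}" and dec: "\<And>n. s (Suc n) < s n"
  then have "\<forall>n. \<exists>a b. a \<in> A \<and> b \<in> B \<and> s n = a + b" by blast
  then obtain a b where ab: "\<And>n. a n \<in> A" "\<And>n. b n \<in> B" "\<And>n. s n = a n + b n" by metis
  obtain f :: "nat \<Rightarrow> nat" where f: "strict_mono f" "monoseq (\<lambda>n. a (f n))"
    using seq_monosub by blast
  have fl: "f n < f (Suc n)" for n using f(1) by (simp add: strict_mono_Suc_iff)
  have sdec: "s (f (Suc n)) < s (f n)" for n
    using lift_Suc_mono_less[of "\<lambda>n. - s n"] dec fl[of n] by (metis neg_less_iff_less)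
  obtain k where k: "\<And>n. n \<ge> k \<Longrightarrow> a (f n) \<le> a (f (Suc n))"
  proof (cases "\<forall>n. a (f n) \<le> a (f (Suc n))")
    case True
    then show ?thesis using that by blast
  next
    case False
    then have anti: "\<And>m n. m \<le> n \<Longrightarrow> a (f n) \<le> a (f m)"
      using f(2) unfolding monoseq_def by auto
    obtain m where "m \<in> range (\<lambda>n. a (f n))" "\<forall>x\<in>range (\<lambda>n. a (f n)). m \<le> x"
      using assms(1)[unfolded wo_iff_least, rule_format, of "range (\<lambda>n. a (f n))"] ab(1) by auto
    then obtain i where "\<forall>n. a (f i) \<le> a (f n)" by auto
    then have "a (f n) \<le> a (f (Suc n))" if "n \<ge> i" for n using anti[OF that] by (meson order_trans)
    then show ?thesis using that by blast
  qed
  have "b (f (Suc n)) < b (f n)" if "n \<ge> k" for n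
    using sdec[of n] k[OF that] ab(3)[of "f n"] ab(3)[of "f (Suc n)"] by linarith
  then show False
    using wo_no_descent[OF assms(2), of "\<lambda>n. b (f (k + n))"] ab(2) by simp
qed

lemma wo_finite_decomp:
  fixes A B :: "rat set"
  assumes "wfp_on A (<)" "wfp_on B (<)"
  shows "finite {(a, b). a \<in> A \<and> b \<in> B \<and> a + b = q}"
proof -
  define T where "T = {a \<in> A. q - a \<in> B}"
  have least: "\<exists>m\<in>S. \<forall>x\<in>S. m \<le> x" if "S \<subseteq> T" "S \<noteq> {}" for S
    using assms(1)[unfolded wo_iff_least] that unfolding T_def by blast
  have greatest: "\<exists>m\<in>S. \<forall>x\<in>S. x \<le> m" if "S \<subseteq> T" "S \<noteq> {}" for S
  proof -
    have "(\<lambda>a. q - a) ` S \<subseteq> B" "(\<lambda>a. q - a) ` S \<noteq> {}" using that unfolding T_def by auto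
    then have "\<exists>m\<in>(\<lambda>a. q - a) ` S. \<forall>x\<in>(\<lambda>a. q - a) ` S. m \<le> x"
      using assms(2)[unfolded wo_iff_least] by blast
    then show ?thesis by auto
  qed
  have "finite T"
  proof (rule ccontr)
    assume inf: "infinite T"
    define L where "L = {t \<in> T. infinite {x \<in> T. x \<le> t}}"
    have "T \<noteq> {}" using inf by auto
    then obtain t0 where t0: "t0 \<in> T" "\<forall>x\<in>T. x \<le> t0" using greatest[of T] by auto
    then have "{x \<in> T. x \<le> t0} = T" by auto
    then have "t0 \<in> L" using t0 inf by (simp add: L_def)
    then obtain t where t: "t \<in> L" "\<forall>x\<in>L. t \<le> x" using least[of L] by (auto simp: L_def)
    have "{x \<in> T. x \<le> t} = insert t {x \<in> T. x < t}" using t(1) by (auto simp: L_def)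
    then have inf': "infinite {x \<in> T. x < t}" using t(1) by (auto simp: L_def)
    then have "{x \<in> T. x < t} \<noteq> {}" by (metis finite.emptyI)
    then obtain m where m: "m \<in> T" "m < t" "\<forall>x\<in>T. x < t \<longrightarrow> x \<le> m"
      using greatest[of "{x \<in> T. x < t}"] by auto
    have "{x \<in> T. x < t} = {x \<in> T. x \<le> m}" using m by auto
    then have "m \<in> L" using m inf' by (simp add: L_def)
    then show False using t(2) m(2) by auto
  qed
  moreover have "{(a, b). a \<in> A \<and> b \<in> B \<and> a + b = q} \<subseteq> (\<lambda>a. (a, q - a)) ` T"
    by (auto simp: T_def)
  ultimately show ?thesis by (meson finite_imageI finite_subset)
qed

text \<open>
  The power series field \<^emph>\<open>'a((t^\<rat>))\<close>: for the linear order on \<^typ>\<open>rat\<close>, well-foundedness of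
  the support means that it is well-ordered.
\<close>

typedef (overloaded) 'a hahn = "{f :: rat \<Rightarrow> 'a::zero. wfp_on {q. f q \<noteq> 0} (<)}"
  morphisms hcoeff Abs_hahn
proof -
  have "wfp_on {q :: rat. (0::'a) \<noteq> 0} (<)" by (rule wo_finite) simp
  then show ?thesis by (intro exI[of _ "\<lambda>_. 0"]) simp
qed

definition supp :: "'a::zero hahn \<Rightarrow> rat set" where
  "supp f = {q. hcoeff f q \<noteq> 0}"

lemma wo_supp: "wfp_on (supp f) (<)"
  using hcoeff[of f] by (simp add: supp_def)

lemma hahn_eqI: "(\<And>q. hcoeff f q = hcoeff g q) \<Longrightarrow> f = g"
  using hcoeff_inject by blast

lemma hcoeff_Abs: "{q. f q \<noteq> 0} \<subseteq> A \<Longrightarrow> wfp_on A (<) \<Longrightarrow> hcoeff (Abs_hahn f) = f"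
  by (intro Abs_hahn_inverse) (auto intro: wfp_on_subset)

instantiation hahn :: (zero) zero
begin
definition zero_hahn_def: "0 = Abs_hahn (\<lambda>_. 0)"
instance ..
end

lemma hcoeff_zero [simp]: "hcoeff 0 q = 0"
  unfolding zero_hahn_def by (subst hcoeff_Abs[where A = "{}"]) (auto intro: wo_finite)

definition hmonom :: "'a::zero \<Rightarrow> rat \<Rightarrow> 'a hahn" where
  "hmonom c r = Abs_hahn (\<lambda>q. if q = r then c else 0)"

lemma hcoeff_hmonom [simp]: "hcoeff (hmonom c r) q = (if q = r then c else 0)"
  unfolding hmonom_def by (subst hcoeff_Abs[where A = "{r}"]) (auto intro: wo_finite)

instantiation hahn :: ("{zero,one}") one
begin
definition one_hahn_def: "1 = hmonom 1 0"
instance ..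
end

lemma hcoeff_one [simp]: "hcoeff 1 q = (if q = 0 then 1 else 0)"
  by (simp add: one_hahn_def)

instantiation hahn :: (ab_group_add) ab_group_add
begin

definition plus_hahn_def: "f + g = Abs_hahn (\<lambda>q. hcoeff f q + hcoeff g q)"
definition uminus_hahn_def: "- f = Abs_hahn (\<lambda>q. - hcoeff f q)"
definition minus_hahn_def: "f - g = Abs_hahn (\<lambda>q. hcoeff f q - hcoeff g q)"

lemma hcoeff_plus [simp]: "hcoeff (f + g) q = hcoeff f q + hcoeff g q"
  unfolding plus_hahn_def
  by (subst hcoeff_Abs[where A = "supp f \<union> supp g"]) (auto simp: supp_def wo_Un[OF wo_supp wo_supp, unfolded supp_def])

lemma hcoeff_uminus [simp]: "hcoeff (- f) q = - hcoeff f q"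
  unfolding uminus_hahn_def
  by (subst hcoeff_Abs[where A = "supp f"]) (auto simp: supp_def wo_supp[unfolded supp_def])

lemma hcoeff_minus [simp]: "hcoeff (f - g) q = hcoeff f q - hcoeff g q"
  unfolding minus_hahn_def
  by (subst hcoeff_Abs[where A = "supp f \<union> supp g"]) (auto simp: supp_def wo_Un[OF wo_supp wo_supp, unfolded supp_def])

instance
  by standard (auto intro!: hahn_eqI simp: algebra_simps)

end

lemma hcoeff_sum: "hcoeff (\<Sum>i\<in>S. f i) q = (\<Sum>i\<in>S. hcoeff (f i) q)"
  by (induction S rule: infinite_finite_induct) auto

instantiation hahn :: (comm_ring_1) comm_ring_1
begin

definition times_hahn_def:
  "f * g = Abs_hahn (\<lambda>q. \<Sum>(a, b) \<in> {(a, b). a \<in> supp f \<and> b \<in> supp g \<and> a + b = q}.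
     hcoeff f a * hcoeff g b)"

lemma hcoeff_times_supp:
  "hcoeff (f * g) q =
     (\<Sum>(a, b) \<in> {(a, b). a \<in> supp f \<and> b \<in> supp g \<and> a + b = q}. hcoeff f a * hcoeff g b)"
proof -
  have "{q. (\<Sum>(a, b) \<in> {(a, b). a \<in> supp f \<and> b \<in> supp g \<and> a + b = q}.
      hcoeff f a * hcoeff g b) \<noteq> 0} \<subseteq> {a + b |a b. a \<in> supp f \<and> b \<in> supp g}"
  proof safe
    fix q assume "(\<Sum>(a, b) \<in> {(a, b). a \<in> supp f \<and> b \<in> supp g \<and> a + b = q}.
      hcoeff f a * hcoeff g b) \<noteq> 0"
    then have "{(a, b). a \<in> supp f \<and> b \<in> supp g \<and> a + b = q} \<noteq> {}"
      by (metis sum.empty)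
    then show "\<exists>a b. q = a + b \<and> a \<in> supp f \<and> b \<in> supp g" by auto
  qed
  from hcoeff_Abs[OF this wo_sum[OF wo_supp wo_supp]] show ?thesis
    unfolding times_hahn_def by simp
qed

lemma hcoeff_times:
  assumes "wfp_on A (<)" "wfp_on B (<)" "supp f \<subseteq> A" "supp g \<subseteq> B"
  shows "hcoeff (f * g) q =
     (\<Sum>(a, b) \<in> {(a, b). a \<in> A \<and> b \<in> B \<and> a + b = q}. hcoeff f a * hcoeff g b)"
  unfolding hcoeff_times_supp
  by (rule sum.mono_neutral_left)
    (use assms wo_finite_decomp[OF assms(1,2)] in \<open>auto simp: supp_def\<close>)

lemma supp_times: "supp (f * g) \<subseteq> {a + b |a b. a \<in> supp f \<and> b \<in> supp g}"
proof
  fix q assume "q \<in> supp (f * g)"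
  then have "hcoeff (f * g) q \<noteq> 0" by (simp add: supp_def)
  then have "{(a, b). a \<in> supp f \<and> b \<in> supp g \<and> a + b = q} \<noteq> {}"
    unfolding hcoeff_times_supp by (metis sum.empty)
  then show "q \<in> {a + b |a b. a \<in> supp f \<and> b \<in> supp g}" by auto
qed

instance
proof
  fix f g h :: "'a hahn"
  show comm: "f * g = g * f" for f g :: "'a hahn"
  proof (rule hahn_eqI)
    fix q
    show "hcoeff (f * g) q = hcoeff (g * f) q"
      unfolding hcoeff_times_supp
      by (rule sum.reindex_bij_witness[of _ "\<lambda>(a, b). (b, a)" "\<lambda>(a, b). (b, a)"])
        (auto simp: mult.commute)
  qed
  show "(f + g) * h = f * h + g * h"
  proof (rule hahn_eqI)
    fix q
    let ?A = "supp f \<union> supp g"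
    have A: "wfp_on ?A (<)" by (intro wo_Un wo_supp)
    have "supp (f + g) \<subseteq> ?A" by (auto simp: supp_def)
    then show "hcoeff ((f + g) * h) q = hcoeff (f * h + g * h) q"
      using hcoeff_times[OF A wo_supp[of h], of _ h]
      by (simp add: sum.distrib[symmetric] case_prod_unfold algebra_simps)
  qed
  show "1 * f = f"
  proof (rule hahn_eqI)
    fix q
    have w: "wfp_on {0::rat} (<)" "wfp_on (insert q (supp f)) (<)"
      using wo_Un[OF wo_finite[of "{q}"] wo_supp[of f]] by (auto intro: wo_finite)
    have "hcoeff (1 * f) q = (\<Sum>(a, b) \<in> {(a, b). a \<in> {0} \<and> b \<in> insert q (supp f) \<and> a + b = q}.
        hcoeff 1 a * hcoeff f b)"
      by (rule hcoeff_times[OF w]) (auto simp: supp_def)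
    also have "{(a, b). a \<in> {0} \<and> b \<in> insert q (supp f) \<and> a + b = q} = {(0, q)}" by auto
    finally show "hcoeff (1 * f) q = hcoeff f q" by simp
  qed
  show "(0 :: 'a hahn) \<noteq> 1"
  proof
    assume "(0 :: 'a hahn) = 1"
    from arg_cong[OF this, of "\<lambda>f. hcoeff f 0"] show False by simp
  qed
  show "f * g * h = f * (g * h)"
  proof (rule hahn_eqI)
    fix q
    let ?A = "supp f" and ?B = "supp g" and ?C = "supp h"
    let ?AB = "{a + b |a b. a \<in> ?A \<and> b \<in> ?B}" and ?BC = "{a + b |a b. a \<in> ?B \<and> b \<in> ?C}"
    note wo = wo_supp[of f] wo_supp[of g] wo_supp[of h]
    note woAB = wo_sum[OF wo(1,2)] and woBC = wo_sum[OF wo(2,3)]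
    let ?F = "\<lambda>a b c. hcoeff f a * hcoeff g b * hcoeff h c"
    have "hcoeff (f * g * h) q =
        (\<Sum>(p, c) \<in> {(p, c). p \<in> ?AB \<and> c \<in> ?C \<and> p + c = q}. hcoeff (f * g) p * hcoeff h c)"
      by (rule hcoeff_times[OF woAB wo(3) supp_times]) simp
    also have "\<dots> = (\<Sum>x \<in> {(p, c). p \<in> ?AB \<and> c \<in> ?C \<and> p + c = q}.
        \<Sum>y \<in> {(a, b). a \<in> ?A \<and> b \<in> ?B \<and> a + b = fst x}. ?F (fst y) (snd y) (snd x))"
      by (rule sum.cong) (auto simp: hcoeff_times_supp sum_distrib_right case_prod_unfold)
    also have "\<dots> = (\<Sum>z \<in> (SIGMA x : {(p, c). p \<in> ?AB \<and> c \<in> ?C \<and> p + c = q}.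
        {(a, b). a \<in> ?A \<and> b \<in> ?B \<and> a + b = fst x}).
        ?F (fst (snd z)) (snd (snd z)) (snd (fst z)))"
      by (subst sum.Sigma)
        (use wo_finite_decomp[OF woAB wo(3)] wo_finite_decomp[OF wo(1,2)] in
          \<open>auto simp: case_prod_unfold\<close>)
    also have "\<dots> = (\<Sum>z \<in> (SIGMA x : {(a, p). a \<in> ?A \<and> p \<in> ?BC \<and> a + p = q}.
        {(b, c). b \<in> ?B \<and> c \<in> ?C \<and> b + c = snd x}).
        ?F (fst (fst z)) (fst (snd z)) (snd (snd z)))"
      by (rule sum.reindex_bij_witness[of _
            "\<lambda>((a, p), (b, c)). ((a + b, c), (a, b))" "\<lambda>((p, c), (a, b)). ((a, b + c), (b, c))"])
        (auto simp: add.assoc)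
    also have "\<dots> = (\<Sum>x \<in> {(a, p). a \<in> ?A \<and> p \<in> ?BC \<and> a + p = q}.
        \<Sum>y \<in> {(b, c). b \<in> ?B \<and> c \<in> ?C \<and> b + c = snd x}. ?F (fst x) (fst y) (snd y))"
      by (subst sum.Sigma)
        (use wo_finite_decomp[OF wo(1) woBC] wo_finite_decomp[OF wo(2,3)] in
          \<open>auto simp: case_prod_unfold\<close>)
    also have "\<dots> = (\<Sum>(a, p) \<in> {(a, p). a \<in> ?A \<and> p \<in> ?BC \<and> a + p = q}.
        hcoeff f a * hcoeff (g * h) p)"
      by (rule sum.cong) (auto simp: hcoeff_times_supp sum_distrib_left case_prod_unfold mult.assoc)
    also have "\<dots> = hcoeff (f * (g * h)) q"
      by (rule hcoeff_times[OF wo(1) woBC _ supp_times, symmetric]) simp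
    finally show "hcoeff (f * g * h) q = hcoeff (f * (g * h)) q" .
  qed
qed

end

lemma vanish_times:
  fixes f g :: "'a::comm_ring_1 hahn"
  assumes "\<And>q. q < a \<Longrightarrow> hcoeff f q = 0" "\<And>q. q < b \<Longrightarrow> hcoeff g q = 0" "q < a + b"
  shows "hcoeff (f * g) q = 0"
proof (rule ccontr)
  assume "hcoeff (f * g) q \<noteq> 0"
  then have "q \<in> supp (f * g)" by (simp add: supp_def)
  then obtain p r where "hcoeff f p \<noteq> 0" "hcoeff g r \<noteq> 0" "q = p + r"
    using supp_times by (fastforce simp: supp_def)
  moreover from this have "a \<le> p" "b \<le> r" using assms(1,2) by (meson not_le)+
  ultimately show False using assms(3) by linarith
qed

lemma hcoeff_times_lowest:
  fixes f g :: "'a::comm_ring_1 hahn"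
  assumes "\<And>q. q < a \<Longrightarrow> hcoeff f q = 0" "\<And>q. q < b \<Longrightarrow> hcoeff g q = 0"
  shows "hcoeff (f * g) (a + b) = hcoeff f a * hcoeff g b"
proof -
  have "{(p, q). p \<in> supp f \<and> q \<in> supp g \<and> p + q = a + b} \<subseteq> {(a, b)}"
  proof clarsimp
    fix p q assume *: "p \<in> supp f" "q \<in> supp g" "p + q = a + b"
    then have "a \<le> p" "b \<le> q" using assms by (auto simp: supp_def not_less[symmetric])
    with *(3) show "p = a \<and> q = b" by linarith
  qed
  then have "hcoeff (f * g) (a + b) = (\<Sum>(p, q)\<in>{(a, b)}. hcoeff f p * hcoeff g q)"
    unfolding hcoeff_times_supp by (intro sum.mono_neutral_left) (auto simp: supp_def)
  then show ?thesis by simp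
qed

lemma hcoeff_hmonom_times:
  fixes f :: "'a::comm_ring_1 hahn"
  shows "hcoeff (hmonom c r * f) q = c * hcoeff f (q - r)"
proof -
  have w: "wfp_on {r} (<)" "wfp_on (insert (q - r) (supp f)) (<)"
    using wo_Un[OF wo_finite[of "{q - r}"] wo_supp[of f]] by (auto intro: wo_finite)
  have "hcoeff (hmonom c r * f) q =
      (\<Sum>(a, b) \<in> {(a, b). a \<in> {r} \<and> b \<in> insert (q - r) (supp f) \<and> a + b = q}.
        hcoeff (hmonom c r) a * hcoeff f b)"
    by (rule hcoeff_times[OF w]) (auto simp: supp_def)
  also have "{(a, b). a \<in> {r} \<and> b \<in> insert (q - r) (supp f) \<and> a + b = q} = {(r, q - r)}" by auto
  finally show ?thesis by simp
qed

text \<open>The canonical valuation (lowest exponent); only meaningful for nonzero series.\<close>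

definition hval :: "'a::zero hahn \<Rightarrow> rat" where
  "hval f = (LEAST q. q \<in> supp f)"

lemma hval:
  assumes "f \<noteq> 0"
  shows "hcoeff f (hval f) \<noteq> 0" "q < hval f \<Longrightarrow> hcoeff f q = 0"
proof -
  have "supp f \<noteq> {}"
    using assms hahn_eqI[of f 0] by (auto simp: supp_def)
  then have "\<exists>m\<in>supp f. \<forall>x\<in>supp f. m \<le> x"
    using wo_supp[of f, unfolded wo_iff_least, rule_format, of "supp f"] by simp
  then obtain m where m: "m \<in> supp f" "\<And>x. x \<in> supp f \<Longrightarrow> m \<le> x" by auto
  then have "hval f = m" unfolding hval_def by (intro Least_equality) auto
  with m show "hcoeff f (hval f) \<noteq> 0" "q < hval f \<Longrightarrow> hcoeff f q = 0"
    by (auto simp: supp_def not_less[symmetric])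
qed

lemma wo_UN_finite:
  fixes A :: "'i \<Rightarrow> 'a::linorder set"
  assumes "finite I" "\<And>i. i \<in> I \<Longrightarrow> wfp_on (A i) (<)"
  shows "wfp_on (\<Union>i\<in>I. A i) (<)"
  using assms
proof (induction I rule: finite_induct)
  case empty
  then show ?case by (simp add: wo_finite)
next
  case (insert i I)
  then show ?case using wo_Un[of "A i"] by simp
qed

lemma geometric_inverse:
  fixes x :: "'a::comm_ring_1 hahn"
  assumes "\<delta> > 0" "\<And>q. q < \<delta> \<Longrightarrow> hcoeff x q = 0"
  shows "\<exists>y. (1 - x) * y = 1"
proof -
  have pow: "hcoeff (x ^ n) q = 0" if "q < of_nat n * \<delta>" for n q
    using that
  proof (induction n arbitrary: q)
    case (Suc n)
    have "hcoeff (x * x ^ n) q = 0"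
      by (rule vanish_times[of \<delta> _ "of_nat n * \<delta>"])
        (use assms Suc in \<open>auto simp: algebra_simps\<close>)
    then show ?case by simp
  qed auto
  define N where "N = (\<lambda>q. nat (\<lceil>q / \<delta>\<rceil> + 1))"
  have N: "hcoeff (x ^ n) q = 0" if "q \<le> r" "N r \<le> n" for q r :: rat and n
  proof (rule pow)
    have "\<lceil>r / \<delta>\<rceil> + 1 \<le> int n" using that(2) unfolding N_def by linarith
    then have "r / \<delta> < of_nat n"
      by (metis le_of_int_ceiling less_add_one of_int_add of_int_le_iff of_int_1 of_int_of_nat_eq
          order_le_less_trans order_less_le_trans)
    then have "r < of_nat n * \<delta>" using assms(1) by (simp add: pos_divide_less_eq)
    with that(1) show "q < of_nat n * \<delta>" by linarith
  qed
  define c where "c = (\<lambda>q. \<Sum>n<N q. hcoeff (x ^ n) q)"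
  have c: "c q = (\<Sum>n<M. hcoeff (x ^ n) q)" if "N r \<le> M" "q \<le> r" for q r :: rat and M
  proof -
    have "c q = (\<Sum>n<max M (N q). hcoeff (x ^ n) q)"
      unfolding c_def by (rule sum.mono_neutral_left) (auto intro: N[of q q])
    also have "\<dots> = (\<Sum>n<M. hcoeff (x ^ n) q)"
      by (rule sum.mono_neutral_right) (use that in \<open>auto intro: N[of q r]\<close>)
    finally show ?thesis .
  qed
  have "wfp_on {q. c q \<noteq> 0} (<)"
    unfolding wo_iff_least
  proof (intro allI impI)
    fix S assume S: "S \<subseteq> {q. c q \<noteq> 0}" "S \<noteq> {}"
    then obtain s where s: "s \<in> S" by blast
    let ?U = "\<Union>n\<in>{..<N s}. supp (x ^ n)"
    have "wfp_on ?U (<)" by (rule wo_UN_finite) (auto intro: wo_supp)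
    moreover have "S \<inter> {..s} \<subseteq> ?U"
    proof
      fix q assume q: "q \<in> S \<inter> {..s}"
      then have "(\<Sum>n<N s. hcoeff (x ^ n) q) \<noteq> 0" using S(1) c[of s "N s" q] by auto
      then obtain n where "n < N s" "hcoeff (x ^ n) q \<noteq> 0"
        by (metis lessThan_iff sum.neutral)
      then show "q \<in> ?U" by (auto simp: supp_def)
    qed
    moreover have "S \<inter> {..s} \<noteq> {}" using s by auto
    ultimately have "\<exists>m\<in>S \<inter> {..s}. \<forall>x\<in>S \<inter> {..s}. m \<le> x"
      unfolding wo_iff_least by (elim allE impE) assumption+
    then obtain m where m: "m \<in> S" "m \<le> s" "\<And>x. x \<in> S \<Longrightarrow> x \<le> s \<Longrightarrow> m \<le> x"
      by auto
    have "m \<le> x" if "x \<in> S" for x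
      using m(2) m(3)[OF that] by (cases "x \<le> s") auto
    with m(1) show "\<exists>m\<in>S. \<forall>x\<in>S. m \<le> x" by blast
  qed
  then have y: "hcoeff (Abs_hahn c) = c" by (rule hcoeff_Abs[OF order.refl])
  have "(1 - x) * Abs_hahn c = 1"
  proof (rule hahn_eqI)
    fix q :: rat
    define r where "r = q + 1"
    define e where "e = Abs_hahn c - (\<Sum>n<N r. x ^ n)"
    have e: "hcoeff e p = 0" if "p < r" for p
      using c[of r "N r" p] that by (simp add: e_def y hcoeff_sum)
    have x0: "hcoeff (1 - x) p = 0" if "p < 0" for p using assms that by auto
    have "(1 - x) * Abs_hahn c = (1 - x) * (\<Sum>n<N r. x ^ n) + (1 - x) * e"
      by (simp add: e_def algebra_simps)
    also have "(1 - x) * (\<Sum>n<N r. x ^ n) = 1 - x ^ N r" by (simp add: one_diff_power_eq)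
    finally have eq: "(1 - x) * Abs_hahn c = 1 - x ^ N r + (1 - x) * e" .
    have "hcoeff ((1 - x) * e) q = 0"
      by (rule vanish_times[of 0 _ r, OF x0 e]) (auto simp: r_def)
    moreover have "hcoeff (x ^ N r) q = 0" by (rule N[of q r]) (auto simp: r_def)
    ultimately show "hcoeff ((1 - x) * Abs_hahn c) q = hcoeff 1 q" unfolding eq by simp
  qed
  then show ?thesis by blast
qed

lemma hahn_unit:
  fixes f :: "'a::field hahn"
  assumes "f \<noteq> 0"
  shows "\<exists>g. f * g = 1"
proof -
  define d where "d = hval f"
  define m where "m = hmonom (1 / hcoeff f d) (- d)"
  define x where "x = 1 - m * f"
  note v = hval[OF assms, folded d_def]
  have x0: "hcoeff x q = 0" if "q \<le> 0" for q
    using v that by (cases "q = 0") (auto simp: x_def m_def hcoeff_hmonom_times)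
  obtain \<delta> where "\<delta> > 0" "\<And>q. q < \<delta> \<Longrightarrow> hcoeff x q = 0"
  proof (cases "x = 0")
    case True
    then show ?thesis using that[of 1] by simp
  next
    case False
    from hval[OF this] x0 have "hval x > 0" by (meson not_le)
    then show ?thesis using that hval(2)[OF False] by blast
  qed
  from geometric_inverse[OF this] obtain y where "(1 - x) * y = 1" by blast
  then have "f * (m * y) = 1" by (simp add: x_def algebra_simps)
  then show ?thesis by blast
qed

instantiation hahn :: (field) field
begin

definition inverse_hahn_def: "inverse f = (if f = 0 then 0 else SOME g. f * g = (1 :: 'a hahn))"
definition divide_hahn_def: "f div g = f * inverse (g :: 'a hahn)"

lemma hahn_right_inverse: "f * inverse f = 1" if "f \<noteq> 0" for f :: "'a hahn"
proof -
  have "inverse f = (SOME g. f * g = 1)" using that by (simp only: inverse_hahn_def if_False)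
  then show ?thesis using someI_ex[OF hahn_unit[OF that]] by (simp only:)
qed

instance
proof
  fix f g :: "'a hahn"
  show "inverse f * f = 1" if "f \<noteq> 0"
    using hahn_right_inverse[OF that] by (simp only: mult.commute[of "inverse f" f])
  show "f div g = f * inverse g" by (rule divide_hahn_def)
  show "inverse (0 :: 'a hahn) = 0" by (simp add: inverse_hahn_def)
qed

end

definition hpos :: "'a::linordered_field hahn \<Rightarrow> bool" where
  "hpos f \<longleftrightarrow> f \<noteq> 0 \<and> hcoeff f (hval f) > 0"

lemma hpos_iff: "hpos f \<longleftrightarrow> (\<exists>q. hcoeff f q > 0 \<and> (\<forall>p<q. hcoeff f p = 0))"
proof
  assume "hpos f"
  then show "\<exists>q. hcoeff f q > 0 \<and> (\<forall>p<q. hcoeff f p = 0)"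
    using hval(2)[of f] unfolding hpos_def by (intro exI[of _ "hval f"]) simp
next
  assume "\<exists>q. hcoeff f q > 0 \<and> (\<forall>p<q. hcoeff f p = 0)"
  then obtain q where q: "hcoeff f q > 0" "\<forall>p<q. hcoeff f p = 0" by blast
  then have "f \<noteq> 0" by auto
  moreover have "hval f = q"
  proof (rule antisym; rule ccontr)
    show False if "\<not> hval f \<le> q" using hval(2)[OF \<open>f \<noteq> 0\<close>, of q] q(1) that by simp
    show False if "\<not> q \<le> hval f" using hval(1)[OF \<open>f \<noteq> 0\<close>] q(2) that by simp
  qed
  ultimately show "hpos f" using q by (simp add: hpos_def)
qed

lemma hpos_trichotomy: "f = 0 \<or> hpos f \<or> hpos (- f)"
proof (cases "f = 0")
  case False
  note v = hval[OF this]
  show ?thesis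
  proof (cases "hcoeff f (hval f) > 0")
    case True
    with \<open>f \<noteq> 0\<close> show ?thesis by (simp add: hpos_def)
  next
    case neg: False
    then have "hcoeff (- f) (hval f) > 0 \<and> (\<forall>p<hval f. hcoeff (- f) p = 0)"
      using v by simp
    then have "hpos (- f)" unfolding hpos_iff by (rule exI)
    then show ?thesis by simp
  qed
qed simp

lemma not_hpos_zero: "\<not> hpos 0"
  by (simp add: hpos_def)

lemma hpos_add: "hpos f \<Longrightarrow> hpos g \<Longrightarrow> hpos (f + g)"
proof -
  assume "hpos f" "hpos g"
  then obtain a b where a: "hcoeff f a > 0" "\<forall>p<a. hcoeff f p = 0"
    and b: "hcoeff g b > 0" "\<forall>p<b. hcoeff g p = 0" unfolding hpos_iff by blast
  consider "a < b" | "a = b" | "b < a" by linarith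
  then have "hcoeff (f + g) (min a b) > 0 \<and> (\<forall>p<min a b. hcoeff (f + g) p = 0)"
    using a b by cases (auto simp: min_def)
  then show ?thesis unfolding hpos_iff by blast
qed

lemma hpos_mult: "hpos f \<Longrightarrow> hpos g \<Longrightarrow> hpos (f * g)"
proof -
  assume "hpos f" "hpos g"
  then obtain a b where a: "hcoeff f a > 0" "\<And>p. p < a \<Longrightarrow> hcoeff f p = 0"
    and b: "hcoeff g b > 0" "\<And>p. p < b \<Longrightarrow> hcoeff g p = 0" unfolding hpos_iff by blast
  have "hcoeff (f * g) (a + b) > 0 \<and> (\<forall>p<a + b. hcoeff (f * g) p = 0)"
    using a(1) b(1) hcoeff_times_lowest[OF a(2) b(2)] vanish_times[OF a(2) b(2)] by simp
  then show ?thesis unfolding hpos_iff by blast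
qed

instantiation hahn :: (linordered_field) linordered_field
begin

definition less_hahn_def: "f < g \<longleftrightarrow> hpos (g - f)"
definition less_eq_hahn_def: "f \<le> g \<longleftrightarrow> f = g \<or> f < (g :: 'a hahn)"
definition abs_hahn_def: "\<bar>f\<bar> = (if f < 0 then - f else (f :: 'a hahn))"
definition sgn_hahn_def: "sgn f = (if f = 0 then 0 else if 0 < f then 1 else - 1 :: 'a hahn)"

instance
proof
  fix f g h :: "'a hahn"
  have trans: "f < h" if "f < g" "g < h" for f g h :: "'a hahn"
    using hpos_add[of "g - f" "h - g"] that by (simp add: less_hahn_def)
  have irrefl: "\<not> f < f" for f :: "'a hahn"
    by (simp add: less_hahn_def not_hpos_zero)
  show "f < g \<longleftrightarrow> f \<le> g \<and> \<not> g \<le> f"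
    using trans[of f g f] irrefl by (auto simp: less_eq_hahn_def)
  show "f \<le> f" by (simp add: less_eq_hahn_def)
  show "f \<le> g \<Longrightarrow> g \<le> h \<Longrightarrow> f \<le> h" using trans by (auto simp: less_eq_hahn_def)
  show "f \<le> g \<Longrightarrow> g \<le> f \<Longrightarrow> f = g" using trans[of f g f] irrefl[of f] by (auto simp: less_eq_hahn_def)
  show "f \<le> g \<or> g \<le> f"
    using hpos_trichotomy[of "g - f"] by (auto simp: less_eq_hahn_def less_hahn_def)
  show "f \<le> g \<Longrightarrow> h + f \<le> h + g" by (auto simp: less_eq_hahn_def less_hahn_def)
  show "f < g \<Longrightarrow> 0 < h \<Longrightarrow> h * f < h * g"
    using hpos_mult[of h "g - f"] by (simp add: less_hahn_def algebra_simps)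
  show "\<bar>f\<bar> = (if f < 0 then - f else f)" by (rule abs_hahn_def)
  show "sgn f = (if f = 0 then 0 else if 0 < f then 1 else - 1)" by (rule sgn_hahn_def)
qed

end

lemma zero_less_hahn_iff: "0 < f \<longleftrightarrow> f \<noteq> 0 \<and> 0 < hcoeff f (hval f)"
  by (simp add: less_hahn_def hpos_def)

text \<open>
  The coefficient field \<^emph>\<open>k\<close> is a subset of the ambient coefficient type, so that
  \<^emph>\<open>k((t^\<rat>))\<close> is a subset of \<^emph>\<open>'a hahn\<close> and inherits its operations and its order.
\<close>

definition power_series :: "'a::field set \<Rightarrow> 'a hahn set" where
  "power_series k = {f. \<forall>q. hcoeff f q \<in> k}"

text \<open>
  \<^emph>\<open>k((t^(1/n)))\<close>: a subset of \<^emph>\<open>(1/n)\<int>\<close> is well-ordered iff it is bounded below, so the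
  exponents occurring in such a series are bounded below automatically.
\<close>

definition laurent_series :: "'a::field set \<Rightarrow> nat \<Rightarrow> 'a hahn set" where
  "laurent_series k n = {f \<in> power_series k. supp f \<subseteq> range (\<lambda>i :: int. of_int i / of_nat n)}"

definition PSF :: "'a::field set \<Rightarrow> 'a hahn set" where
  "PSF k = (\<Union>n\<in>{1..}. laurent_series k n)"

text \<open>
  The power series field \<^emph>\<open>k((t^\<rat>))\<close> is complete with respect to its valuation, so the
  completion of a subfield is its closure in the valuation topology.
\<close>

definition valuation_closure :: "'a::field set \<Rightarrow> 'a hahn set \<Rightarrow> 'a hahn set" where
  "valuation_closure k K =
     {f \<in> power_series k. \<forall>r. \<exists>g\<in>K. f = g \<or> hval (f - g) > r}"

definition PSF_completion :: "'a::field set \<Rightarrow> 'a hahn set" where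
  "PSF_completion k = valuation_closure k (PSF k)"

definition Qrc :: "real set" where
  "Qrc = {x. algebraic x}"

definition is_subring :: "'a::comm_ring_1 set \<Rightarrow> bool" where
  "is_subring R \<longleftrightarrow> 0 \<in> R \<and> 1 \<in> R \<and> (\<forall>x\<in>R. \<forall>y\<in>R. x - y \<in> R \<and> x * y \<in> R)"

definition is_subfield :: "'a::field set \<Rightarrow> bool" where
  "is_subfield F \<longleftrightarrow> is_subring F \<and> (\<forall>x\<in>F. inverse x \<in> F)"

definition discretely_ordered :: "'a::linordered_field set \<Rightarrow> bool" where
  "discretely_ordered R \<longleftrightarrow> (\<exists>e\<in>R. 0 < e \<and> (\<forall>x\<in>R. 0 < x \<longrightarrow> e \<le> x))"

definition integer_part :: "'a::linordered_field set \<Rightarrow> 'a set \<Rightarrow> bool" where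
  "integer_part K I \<longleftrightarrow> I \<subseteq> K \<and> is_subring I \<and> discretely_ordered I \<and>
     (\<forall>a\<in>K. \<exists>r\<in>I. r \<le> a \<and> a < r + 1)"

definition Quot :: "'a::field set \<Rightarrow> 'a set" where
  "Quot R = {a / b |a b. a \<in> R \<and> b \<in> R \<and> b \<noteq> 0}"

definition algebraic_over :: "'a::field set \<Rightarrow> 'a \<Rightarrow> bool" where
  "algebraic_over F x \<longleftrightarrow> (\<exists>p. p \<noteq> 0 \<and> (\<forall>i. poly.coeff p i \<in> F) \<and> poly p x = 0)"

text \<open>
  Polynomials in variables indexed by field elements, where the variable with index \<^emph>\<open>b\<close> is
  evaluated at \<^emph>\<open>b\<close>. A monomial is a finitely supported map from variables to exponents.
\<close>

definition eval_self :: "(('a \<Rightarrow>\<^sub>0 nat) \<Rightarrow>\<^sub>0 'a::field) \<Rightarrow> 'a" where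
  "eval_self p =
     (\<Sum>m\<in>Poly_Mapping.keys p. Poly_Mapping.lookup p m *
        (\<Prod>b\<in>Poly_Mapping.keys m. b ^ Poly_Mapping.lookup m b))"

definition algebraically_independent :: "'a::field set \<Rightarrow> 'a set \<Rightarrow> bool" where
  "algebraically_independent F B \<longleftrightarrow>
     (\<forall>p. (\<forall>m\<in>Poly_Mapping.keys p. Poly_Mapping.lookup p m \<in> F \<and> Poly_Mapping.keys m \<subseteq> B) \<and>
        eval_self p = 0 \<longrightarrow> p = 0)"

definition transcendence_basis :: "'a::field set \<Rightarrow> 'a set \<Rightarrow> 'a set \<Rightarrow> bool" where
  "transcendence_basis F L B \<longleftrightarrow>
     B \<subseteq> L \<and> algebraically_independent F B \<and>
     (\<forall>x\<in>L. algebraic_over (is_subfield hull (F \<union> B)) x)"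

text \<open>
  The transcendence degree of \<^emph>\<open>L\<close> over \<^emph>\<open>F\<close> is the cardinality of any transcendence basis;
  the following says that this cardinal is uncountable, without choosing a basis.
\<close>

definition uncountable_trdeg :: "'a::field set \<Rightarrow> 'a set \<Rightarrow> bool" where
  "uncountable_trdeg F L \<longleftrightarrow>
     (\<exists>B. transcendence_basis F L B) \<and> (\<forall>B. transcendence_basis F L B \<longrightarrow> uncountable B)"

end

theory Submission
  imports Defs
begin

text \<open>
  Integer parts of these fields are small because a discretely ordered ring contains no nonzero
  infinitesimal (\<open>discrete_subring_no_infinitesimals\<close>). Two elements of an integer part \<open>I\<close>
  that agree at all exponents \<open>\<le> 0\<close> differ by an infinitesimal and hence are equal, so an
  element of \<open>I\<close> is determined by its part with exponents \<open>\<le> 0\<close>. For a Puiseux series this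
  part is a finite sum, and the same holds in the completion, whose elements are
  approximated by Puiseux series beyond exponent 0. There are only countably many real algebraic
  numbers, hence only countably many such finite sums, so \<open>I\<close> and its quotient field are countable
  (\<open>countable_discrete_subring\<close>).

  The Puiseux series field itself is uncountable, since infinitely many coefficients can be
  prescribed at will (\<open>uncountable_PSF\<close>), and so is the larger completion. All remaining claims
  are a matter of cardinality: the quotient field is a proper subfield, and a countable
  transcendence basis over a countable field would make the whole field countable
  (\<open>uncountable_trdeg_if_countable_base\<close>). That transcendence bases exist at all is Zorn's lemma
  (\<open>transcendence_basis_exists\<close>).

  The quotient field lies inside the Puiseux series field, or inside the completion, because both
  are fields. This comes down to two facts: the real algebraic numbers form a
  field (\<open>is_subfield_Qrc\<close>), and inverting a power series leads neither out of the coefficient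
  field nor out of the group of exponents (\<open>is_subfield_series_with_exponents_in\<close>).
\<close>

section \<open>Subrings and subfields\<close>

lemma is_subringD:
  assumes "is_subring R"
  shows "0 \<in> R" "1 \<in> R" "x \<in> R \<Longrightarrow> y \<in> R \<Longrightarrow> x - y \<in> R"
    "x \<in> R \<Longrightarrow> y \<in> R \<Longrightarrow> x * y \<in> R" "x \<in> R \<Longrightarrow> - x \<in> R"
    "x \<in> R \<Longrightarrow> y \<in> R \<Longrightarrow> x + y \<in> R"
proof -
  show *: "0 \<in> R" "1 \<in> R" "x \<in> R \<Longrightarrow> y \<in> R \<Longrightarrow> x - y \<in> R"
    "x \<in> R \<Longrightarrow> y \<in> R \<Longrightarrow> x * y \<in> R" for x y
    using assms by (auto simp: is_subring_def)
  show **: "x \<in> R \<Longrightarrow> - x \<in> R" for x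
    using *(3)[of 0 x] *(1) by simp
  show "x \<in> R \<Longrightarrow> y \<in> R \<Longrightarrow> x + y \<in> R"
    using *(3)[of x "- y"] **[of y] by simp
qed

lemma is_subring_sum:
  assumes "is_subring R" "\<And>i. i \<in> S \<Longrightarrow> f i \<in> R"
  shows "(\<Sum>i\<in>S. f i) \<in> R"
  using assms(2)
  by (induction S rule: infinite_finite_induct) (auto intro: is_subringD[OF assms(1)])

lemma is_subring_prod:
  assumes "is_subring R" "\<And>i. i \<in> S \<Longrightarrow> f i \<in> R"
  shows "(\<Prod>i\<in>S. f i) \<in> R"
  using assms(2)
  by (induction S rule: infinite_finite_induct) (auto intro: is_subringD[OF assms(1)])

lemma is_subring_power:
  assumes "is_subring R" "x \<in> R"
  shows "x ^ n \<in> R"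
  by (induction n) (auto intro: is_subringD[OF assms(1)] assms(2))

lemma is_subfieldD:
  assumes "is_subfield F"
  shows "is_subring F" "x \<in> F \<Longrightarrow> inverse x \<in> F" "x \<in> F \<Longrightarrow> y \<in> F \<Longrightarrow> x / y \<in> F"
  using assms is_subringD(4)[of F x "inverse y"] by (auto simp: is_subfield_def divide_inverse)

lemma is_subfieldI:
  assumes "0 \<in> F" "1 \<in> F" "\<And>x y. x \<in> F \<Longrightarrow> y \<in> F \<Longrightarrow> x - y \<in> F"
    "\<And>x y. x \<in> F \<Longrightarrow> y \<in> F \<Longrightarrow> x * y \<in> F" "\<And>x. x \<in> F \<Longrightarrow> inverse x \<in> F"
  shows "is_subfield F"
  using assms unfolding is_subfield_def is_subring_def by simp

lemma is_subfield_hull: "is_subfield (is_subfield hull S)"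
  by (rule hull_in) (auto simp: is_subfield_def is_subring_def)

lemma is_subfield_Quot:
  assumes "is_subring R"
  shows "is_subfield (Quot R)"
proof -
  note R = is_subringD[OF assms]
  have Q: "a / b \<in> Quot R" if "a \<in> R" "b \<in> R" "b \<noteq> 0" for a b
    using that unfolding Quot_def by blast
  have "x - y \<in> Quot R \<and> x * y \<in> Quot R" if q: "x \<in> Quot R" "y \<in> Quot R" for x y
  proof -
    obtain a b where ab: "a \<in> R" "b \<in> R" "b \<noteq> 0" "x = a / b"
      using q(1) by (auto simp: Quot_def)
    obtain c d where cd: "c \<in> R" "d \<in> R" "d \<noteq> 0" "y = c / d"
      using q(2) by (auto simp: Quot_def)
    from ab cd show ?thesis
      using Q[of "a * d - c * b" "b * d"] Q[of "a * c" "b * d"] R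
      by (simp add: diff_frac_eq)
  qed
  moreover have "inverse x \<in> Quot R" if x: "x \<in> Quot R" for x
  proof -
    obtain a b where ab: "a \<in> R" "b \<in> R" "b \<noteq> 0" "x = a / b"
      using x unfolding Quot_def by blast
    then show ?thesis using Q[of b a] Q[of 0 1] R by (cases "a = 0") auto
  qed
  ultimately show ?thesis
    using Q[of 0 1] Q[of 1 1] R unfolding is_subfield_def is_subring_def by auto
qed

lemma Quot_subset:
  assumes "is_subfield K" "R \<subseteq> K"
  shows "Quot R \<subseteq> K"
  using assms is_subfieldD(3)[OF assms(1)] unfolding Quot_def by blast

lemma countable_Quot:
  assumes "countable R"
  shows "countable (Quot R)"
proof -
  have "Quot R \<subseteq> (\<lambda>(a, b). a / b) ` (R \<times> R)" unfolding Quot_def by auto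
  then show ?thesis by (rule countable_subset) (use assms in auto)
qed

section \<open>Algebraic extensions preserve countability\<close>

lemma countable_polys:
  assumes "countable F"
  shows "countable {p. \<forall>i. poly.coeff p i \<in> F}"
proof -
  have "{p. \<forall>i. poly.coeff p i \<in> F} \<subseteq> Poly ` lists F"
  proof
    fix p assume p: "p \<in> {p. \<forall>i. poly.coeff p i \<in> F}"
    have "coeffs p \<in> lists F"
      using p by (auto simp: coeffs_def)
    then have "Poly (coeffs p) \<in> Poly ` lists F" by (rule imageI)
    then show "p \<in> Poly ` lists F" by simp
  qed
  then show ?thesis by (rule countable_subset) (use assms in auto)
qed

lemma countable_algebraic_over:
  fixes F :: "'a::field set"
  assumes "countable F"
  shows "countable {x. algebraic_over F x}"
proof -
  let ?P = "{p. \<forall>i. poly.coeff p i \<in> F}"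
  have "{x. algebraic_over F x} = (\<Union>p\<in>?P - {0}. {x. poly p x = 0})"
    by (auto simp: algebraic_over_def)
  moreover have "countable (?P - {0})" using countable_polys[OF assms] by auto
  moreover have "countable {x. poly p x = 0}" if "p \<noteq> 0" for p :: "'a poly"
    by (rule countable_finite[OF poly_roots_finite[OF that]])
  ultimately show ?thesis by (auto intro!: countable_UN)
qed

text \<open>
  The hull is defined from above, as an intersection of subfields. Countability needs a
  construction from below: closing under one round of field operations keeps a set countable, and
  the union of the rounds is a subfield, because the rounds increase and so any two elements
  already lie in a common one.
\<close>
lemma countable_subfield_hull:
  fixes S :: "'a::field set"
  assumes "countable S"
  shows "countable (is_subfield hull S)"
proof -
  define step where "step A = A \<union> (\<lambda>(x, y). x - y) ` (A \<times> A) \<union> (\<lambda>(x, y). x * y) ` (A \<times> A) \<union>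
    inverse ` A" for A :: "'a set"
  define C where "C n = (step ^^ n) (S \<union> {0, 1})" for n
  have C: "C 0 = S \<union> {0, 1}" "C (Suc n) = step (C n)" for n by (auto simp: C_def)
  have mono: "C m \<subseteq> C n" if "m \<le> n" for m n
    by (rule lift_Suc_mono_le[OF _ that]) (auto simp: C step_def)
  have "is_subfield (\<Union>n. C n)"
    unfolding is_subfield_def is_subring_def
  proof (intro conjI ballI)
    show "0 \<in> (\<Union>n. C n)" "1 \<in> (\<Union>n. C n)" using C(1) by blast+
    fix x assume "x \<in> (\<Union>n. C n)"
    then obtain m where m: "x \<in> C m" by blast
    then have "inverse x \<in> C (Suc m)" by (simp add: C step_def)
    then show "inverse x \<in> (\<Union>n. C n)" by blast
    fix y assume "y \<in> (\<Union>n. C n)"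
    then obtain n where n: "y \<in> C n" by blast
    have "x \<in> C (max m n)" "y \<in> C (max m n)"
      using m n mono[of m "max m n"] mono[of n "max m n"] by auto
    then have "x - y \<in> C (Suc (max m n))" "x * y \<in> C (Suc (max m n))"
      by (force simp: C step_def)+
    then show "x - y \<in> (\<Union>n. C n)" "x * y \<in> (\<Union>n. C n)" by blast+
  qed
  moreover have "S \<subseteq> (\<Union>n. C n)" using C(1) by blast
  ultimately have "is_subfield hull S \<subseteq> (\<Union>n. C n)" by (intro hull_minimal)
  moreover have "countable (C n)" for n
    by (induction n) (auto simp: C step_def assms)
  ultimately show ?thesis by (meson countable_UN countableI_type countable_subset)
qed

section \<open>The field of algebraic numbers\<close>

text \<open>
  Sums and products of algebraic numbers are algebraic for a dimension reason: a number is
  algebraic iff its powers lie in a finite-dimensional \<open>\<rat>\<close>-space, and if the powers of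
  \<open>x\<close> and of \<open>y\<close> do, then so do all products \<open>x ^ i * y ^ j\<close>, hence all powers of
  \<open>x + y\<close> and \<open>x * y\<close>.
\<close>
interpretation rat_space: vector_space "\<lambda>(q :: rat) x. of_rat q * (x :: 'a::field_char_0)"
  by standard (simp_all add: of_rat_add of_rat_mult algebra_simps)

text \<open>
  Among \<open>card T + 1\<close> powers in a space spanned by \<open>T\<close> there is a linear relation, and its
  coefficients are those of a polynomial that vanishes at \<open>z\<close>.
\<close>
lemma algebraic_if_powers_in_span:
  fixes z :: "'a::field_char_0"
  assumes "finite T" and T: "\<And>n. z ^ n \<in> rat_space.span T"
  shows "algebraic z"
proof -
  let ?N = "{..card T}"
  obtain c :: "nat \<Rightarrow> rat" where c: "(\<Sum>i\<in>?N. of_rat (c i) * z ^ i) = 0" "\<exists>i\<in>?N. c i \<noteq> 0"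
  proof (cases "inj_on ((^) z) ?N")
    case True
    have "rat_space.dependent ((^) z ` ?N)"
    proof (rule ccontr)
      assume "rat_space.independent ((^) z ` ?N)"
      then have "card ((^) z ` ?N) \<le> card T"
        using rat_space.independent_span_bound[OF assms(1)] T by blast
      then show False using True by (simp add: card_image)
    qed
    then obtain u where "\<exists>v\<in>(^) z ` ?N. u v \<noteq> 0" "(\<Sum>v\<in>(^) z ` ?N. of_rat (u v) * v) = 0"
      using rat_space.dependent_finite[of "(^) z ` ?N"] by auto
    then show ?thesis using that[of "\<lambda>i. u (z ^ i)"] True by (auto simp: sum.reindex)
  next
    \<comment> \<open>Two equal powers collapse in the set of powers, so their relation \<open>z ^ i - z ^ j = 0\<close> is
      not seen by linear independence of that set and has to be written down separately.\<close>
    case False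
    then obtain i j where ij: "i \<in> ?N" "j \<in> ?N" "i \<noteq> j" "z ^ i = z ^ j"
      by (auto simp: inj_on_def)
    define c :: "nat \<Rightarrow> rat" where "c l = (if l = i then 1 else 0) - (if l = j then 1 else 0)" for l
    have "(\<Sum>l\<in>?N. of_rat (c l) * z ^ l) =
        (\<Sum>l\<in>?N. (if l = i then z ^ i else 0) - (if l = j then z ^ j else 0))"
      by (rule sum.cong) (auto simp: c_def)
    also have "\<dots> = 0" using ij by (simp add: sum_subtractf)
    finally have "(\<Sum>l\<in>?N. of_rat (c l) * z ^ l) = 0" .
    moreover have "c i \<noteq> 0" using ij(3) by (simp add: c_def)
    ultimately show ?thesis using that[of c] ij(1) by blast
  qed
  define p where "p = (\<Sum>i\<in>?N. monom (of_rat (c i) :: 'a) i)"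
  have coeff: "poly.coeff p i = (if i \<in> ?N then of_rat (c i) else 0)" for i
    by (simp add: p_def coeff_sum)
  show ?thesis
  proof (rule algebraicI')
    show "poly.coeff p i \<in> \<rat>" for i by (simp add: coeff)
    show "p \<noteq> 0" using c(2) coeff by (metis coeff_0 of_rat_eq_0_iff)
    show "poly p z = 0" using c(1) by (simp add: p_def poly_sum poly_monom)
  qed
qed

text \<open>
  A polynomial of degree \<open>n\<close> that vanishes at \<open>x\<close> expresses \<open>x ^ n\<close> by lower powers;
  repeated use of this relation brings every power down to the first \<open>n\<close> ones.
\<close>
lemma powers_in_span_if_algebraic:
  fixes x :: "'a::field_char_0"
  assumes "algebraic x"
  obtains T where "finite T" "\<And>k. x ^ k \<in> rat_space.span T"
proof -
  obtain p where p: "\<And>i. poly.coeff p i \<in> \<rat>" "p \<noteq> 0" "poly p x = 0"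
    using assms unfolding algebraic_altdef by blast
  have "\<forall>i. \<exists>q. poly.coeff p i = of_rat q" using p(1) by (auto simp: Rats_def)
  then obtain c where c: "\<And>i. poly.coeff p i = of_rat (c i)" by metis
  let ?n = "Polynomial.degree p"
  let ?T = "(^) x ` {..<?n}"
  have n: "c ?n \<noteq> 0" using p(2) c[of ?n] by (metis leading_coeff_0_iff of_rat_0)
  have "0 = (\<Sum>i<?n. of_rat (c i) * x ^ i) + of_rat (c ?n) * x ^ ?n"
    using p(3) by (simp add: poly_altdef c lessThan_Suc_atMost[symmetric])
  then have "of_rat (c ?n) * x ^ ?n = - (\<Sum>i<?n. of_rat (c i) * x ^ i)"
    by (simp add: eq_neg_iff_add_eq_0 add.commute)
  then have "x ^ ?n = (- (\<Sum>i<?n. of_rat (c i) * x ^ i)) / of_rat (c ?n)"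
    using n by (simp add: field_simps)
  also have "\<dots> = (\<Sum>i<?n. of_rat (- c i / c ?n) * x ^ i)"
    by (simp add: sum_negf[symmetric] sum_divide_distrib of_rat_divide of_rat_minus)
  finally have xn: "x ^ ?n = (\<Sum>i<?n. of_rat (- c i / c ?n) * x ^ i)" .
  have "x ^ k \<in> rat_space.span ?T" for k
  proof (induction k rule: less_induct)
    case (less k)
    show ?case
    proof (cases "k < ?n")
      case True
      then show ?thesis by (intro rat_space.span_base) auto
    next
      case False
      then have "x ^ k = x ^ ?n * x ^ (k - ?n)" by (simp add: power_add[symmetric])
      also have "\<dots> = (\<Sum>i<?n. of_rat (- c i / c ?n) * x ^ (i + (k - ?n)))"
        unfolding xn by (simp add: sum_distrib_right power_add mult.assoc)
      also have "\<dots> \<in> rat_space.span ?T"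
        by (intro rat_space.span_sum rat_space.span_scale less) (use False in auto)
      finally show ?thesis .
    qed
  qed
  then show ?thesis using that by blast
qed

lemma times_in_span:
  fixes a b :: "'a::field_char_0"
  assumes "a \<in> rat_space.span A" "b \<in> rat_space.span B"
  shows "a * b \<in> rat_space.span ((\<lambda>(x, y). x * y) ` (A \<times> B))" (is "_ \<in> rat_space.span ?AB")
proof -
  have 1: "x * b \<in> rat_space.span ?AB" if "x \<in> A" for x
    using assms(2)
  proof (induction rule: rat_space.span_induct_alt)
    case base
    then show ?case by (simp add: rat_space.span_zero)
  next
    case (step c y z)
    have "x * y \<in> rat_space.span ?AB" using that step by (intro rat_space.span_base) auto
    from rat_space.span_add[OF rat_space.span_scale[OF this] step(2)]
    show ?case by (simp add: algebra_simps)
  qed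
  show ?thesis using assms(1)
  proof (induction rule: rat_space.span_induct_alt)
    case base
    then show ?case by (simp add: rat_space.span_zero)
  next
    case (step c y z)
    from rat_space.span_add[OF rat_space.span_scale[OF 1[OF step(1)]] step(2)]
    show ?case by (simp add: algebra_simps)
  qed
qed

lemma algebraic_add_mult:
  fixes x y :: "'a::field_char_0"
  assumes "algebraic x" "algebraic y"
  shows "algebraic (x + y)" "algebraic (x * y)"
proof -
  obtain A B where A: "finite A" "\<And>k. x ^ k \<in> rat_space.span A"
    and B: "finite B" "\<And>k. y ^ k \<in> rat_space.span B"
    using powers_in_span_if_algebraic[OF assms(1)] powers_in_span_if_algebraic[OF assms(2)] by metis
  let ?AB = "(\<lambda>(x, y). x * y) ` (A \<times> B)"
  have fin: "finite ?AB" using A(1) B(1) by blast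
  have mem: "x ^ i * y ^ j \<in> rat_space.span ?AB" for i j
    by (rule times_in_span[OF A(2) B(2)])
  have "(x + y) ^ n \<in> rat_space.span ?AB" for n
  proof -
    have "(x + y) ^ n = (\<Sum>k\<le>n. of_rat (of_nat (n choose k)) * (x ^ k * y ^ (n - k)))"
      by (simp add: binomial_ring mult.assoc)
    also have "\<dots> \<in> rat_space.span ?AB"
      by (intro rat_space.span_sum rat_space.span_scale mem)
    finally show ?thesis .
  qed
  then show "algebraic (x + y)" by (rule algebraic_if_powers_in_span[OF fin])
  have "(x * y) ^ n \<in> rat_space.span ?AB" for n
    using mem by (simp add: power_mult_distrib)
  then show "algebraic (x * y)" by (rule algebraic_if_powers_in_span[OF fin])
qed

lemma is_subfield_Qrc: "is_subfield Qrc"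
proof -
  have "algebraic (x - y)" if "algebraic x" "algebraic y" for x y :: real
    using algebraic_add_mult(1)[of x "- y"] that by auto
  moreover have "algebraic (1 :: real)"
    by (intro algebraicI[of "[:-1, 1:]"]) (auto simp: coeff_pCons split: nat.splits)
  ultimately show ?thesis
    using algebraic_add_mult(2)
    by (auto simp: is_subfield_def is_subring_def Qrc_def)
qed

lemma countable_Qrc: "countable Qrc"
proof -
  have "Qrc = {x. algebraic_over \<int> x}"
    by (auto simp: Qrc_def algebraic_def algebraic_over_def)
  moreover have "countable {x :: real. algebraic_over \<int> x}"
    by (rule countable_algebraic_over) (simp add: Ints_def)
  ultimately show ?thesis by simp
qed

section \<open>Subfields of the power series field\<close>

lemma hahn_lower_bound:
  obtains l where "\<And>q. q < l \<Longrightarrow> hcoeff f q = 0"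
  using hval(2)[of f] by (cases "f = 0") (auto intro: that)

text \<open>
  Lowest terms multiply, so the product with the inverse can only be \<open>1\<close> if the two valuations
  are opposite.
\<close>
lemma inverse_vanishes_below:
  fixes f :: "'a::field hahn"
  assumes "f \<noteq> 0" "q < - hval f"
  shows "hcoeff (inverse f) q = 0"
proof -
  have nz: "inverse f \<noteq> 0" using assms(1) by simp
  have "hcoeff (f * inverse f) (hval f + hval (inverse f)) \<noteq> 0"
    using hcoeff_times_lowest[of "hval f" f "hval (inverse f)" "inverse f"]
      hval[OF assms(1)] hval[OF nz] by simp
  then have "hval (inverse f) = - hval f" using assms(1) by (auto split: if_splits)
  then show ?thesis using hval(2)[OF nz] assms(2) by simp
qed

text \<open>
  The exponents are restricted to a subgroup \<open>H\<close> of \<open>\<rat>\<close>; taking \<open>H = \<rat>\<close> gives the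
  power series field over \<open>k\<close>, and \<open>H = (1/n)\<int>\<close> gives the Laurent series in \<open>t^(1/n)\<close>.

  Only inverses are not immediate. The inverse \<open>g\<close> of \<open>f\<close> exists in the large field, and its
  coefficients obey a recursion: with \<open>d\<close> the lowest exponent of \<open>f\<close>, comparing coefficients of
  \<open>f * g = 1\<close> at \<open>q + d\<close> writes the coefficient of \<open>g\<close> at \<open>q\<close> by coefficients of \<open>f\<close>
  and by coefficients of \<open>g\<close> at exponents below \<open>q\<close>. A least exponent at which \<open>g\<close> leaves
  \<open>k\<close> or \<open>H\<close> would exist by well-ordering, but the recursion shows that \<open>g\<close> still obeys both
  restrictions there.
\<close>
lemma is_subfield_series_with_exponents_in:
  fixes k :: "'a::field set"
  assumes k: "is_subfield k" and H: "0 \<in> H" "\<And>x y. x \<in> H \<Longrightarrow> y \<in> H \<Longrightarrow> x - y \<in> H"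
  shows "is_subfield {f \<in> power_series k. supp f \<subseteq> H}"
proof -
  let ?K = "{f \<in> power_series k. supp f \<subseteq> H}"
  note kr = is_subringD[OF is_subfieldD(1)[OF k]]
  have Hadd: "x + y \<in> H" if "x \<in> H" "y \<in> H" for x y
    using H(2)[OF that(1) H(2)[OF H(1) that(2)]] by simp
  have K: "f \<in> ?K \<longleftrightarrow> (\<forall>q. hcoeff f q \<in> k \<and> (hcoeff f q \<noteq> 0 \<longrightarrow> q \<in> H))" for f
    by (auto simp: power_series_def supp_def)
  have "f * g \<in> ?K" if "f \<in> ?K" "g \<in> ?K" for f g
  proof -
    have "hcoeff (f * g) q \<in> k" for q
      unfolding hcoeff_times_supp
      by (rule is_subring_sum[OF is_subfieldD(1)[OF k]]) (use that kr K in auto)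
    moreover have "supp (f * g) \<subseteq> H" using supp_times[of f g] that Hadd by blast
    ultimately show ?thesis by (auto simp: power_series_def)
  qed
  moreover have "f - g \<in> ?K" if "f \<in> ?K" "g \<in> ?K" for f g
    using that kr unfolding K by (metis diff_self hcoeff_minus)
  moreover have "inverse f \<in> ?K" if f: "f \<in> ?K" for f
  proof (cases "f = 0")
    case True
    then show ?thesis using f by simp
  next
    case False
    define d where "d = hval f"
    define g where "g = inverse f"
    define bad where "bad = {q. \<not> (hcoeff g q \<in> k \<and> (hcoeff g q \<noteq> 0 \<longrightarrow> q \<in> H))}"
    have fd: "hcoeff f d \<noteq> 0" "\<And>a. hcoeff f a \<noteq> 0 \<Longrightarrow> d \<le> a"
      using hval[OF False] by (auto simp: d_def not_less[symmetric])
    then have d: "d \<in> H" using f unfolding K by blast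
    have "bad = {}"
    proof (rule ccontr)
      assume "bad \<noteq> {}"
      have "bad \<subseteq> supp g" using kr(1) by (auto simp: bad_def supp_def)
      then have "\<exists>q\<in>bad. \<forall>p\<in>bad. q \<le> p"
        using wo_supp[of g, unfolded wo_iff_least, rule_format, of bad] \<open>bad \<noteq> {}\<close> by simp
      then obtain q where q: "q \<in> bad" "\<And>p. p \<in> bad \<Longrightarrow> q \<le> p" by blast
      let ?S = "{(a, b). a \<in> supp f \<and> b \<in> supp g \<and> a + b = q + d}"
      let ?T = "\<Sum>(a, b)\<in>?S - {(d, q)}. hcoeff f a * hcoeff g b"
      have "(d, q) \<in> ?S" using q(1) \<open>bad \<subseteq> supp g\<close> fd(1) by (auto simp: supp_def)
      then have "hcoeff (f * g) (q + d) = hcoeff f d * hcoeff g q + ?T"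
        unfolding hcoeff_times_supp
        by (subst sum.remove[OF wo_finite_decomp[OF wo_supp wo_supp], of "(d, q)"]) auto
      moreover have fg: "f * g = 1" using False by (simp add: g_def)
      ultimately have eq: "hcoeff g q = (hcoeff 1 (q + d) - ?T) / hcoeff f d"
        using fd(1) by (simp add: field_simps)
      have good: "hcoeff f a \<in> k \<and> hcoeff g b \<in> k \<and> a \<in> H \<and> b \<in> H"
        if "(a, b) \<in> ?S - {(d, q)}" for a b
      proof -
        have ab: "hcoeff f a \<noteq> 0" "hcoeff g b \<noteq> 0" "a + b = q + d" "(a, b) \<noteq> (d, q)"
          using that by (auto simp: supp_def)
        have "b < q" using fd(2)[OF ab(1)] ab(3,4) by (cases "a = d") auto
        then have "b \<notin> bad" using q(2) by force
        then show ?thesis using ab f unfolding bad_def K by blast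
      qed
      have "?T \<in> k"
      proof (rule is_subring_sum[OF is_subfieldD(1)[OF k]])
        fix x assume x: "x \<in> ?S - {(d, q)}"
        obtain a b where ab: "x = (a, b)" by fastforce
        have "hcoeff f a * hcoeff g b \<in> k" using good[OF x[unfolded ab]] by (intro kr(4)) blast+
        then show "(case x of (a, b) \<Rightarrow> hcoeff f a * hcoeff g b) \<in> k" by (simp add: ab)
      qed
      moreover have "hcoeff 1 (q + d) \<in> k" using kr(1,2) by simp
      moreover have "hcoeff f d \<in> k" using f unfolding K by blast
      ultimately have 1: "hcoeff g q \<in> k"
        unfolding eq by (intro is_subfieldD(3)[OF k] kr(3))
      have "q \<in> H"
      proof (rule ccontr)
        assume qH: "q \<notin> H"
        have "?S - {(d, q)} = {}"
        proof (rule ccontr)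
          assume "?S - {(d, q)} \<noteq> {}"
          then obtain a b where ab: "(a, b) \<in> ?S - {(d, q)}" by fastforce
          then have "q = a + b - d" by auto
          moreover have "a + b - d \<in> H" using good[OF ab] d by (intro H(2) Hadd) auto
          ultimately show False using qH by simp
        qed
        then have "?T = 0" by (simp only: sum.empty)
        moreover have "q + d \<noteq> 0"
          using qH H(2)[OF H(1) d] by (metis add_eq_0_iff2 diff_0)
        ultimately have "hcoeff g q = 0" unfolding eq by simp
        then show False using q(1) kr(1) by (simp add: bad_def)
      qed
      then show False using q(1) 1 by (simp add: bad_def)
    qed
    then show ?thesis unfolding K g_def bad_def by blast
  qed
  moreover have "0 \<in> ?K" "1 \<in> ?K" unfolding K using kr(1,2) H(1) by auto
  ultimately show ?thesis by (intro is_subfieldI)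
qed

lemma is_subfield_power_series:
  assumes "is_subfield k"
  shows "is_subfield (power_series k)"
  using is_subfield_series_with_exponents_in[OF assms, of UNIV] by simp

lemma is_subfield_laurent_series:
  assumes "is_subfield k"
  shows "is_subfield (laurent_series k n)"
  unfolding laurent_series_def
proof (rule is_subfield_series_with_exponents_in[OF assms])
  show "0 \<in> range (\<lambda>i. of_int i / of_nat n :: rat)" by (rule range_eqI[of _ _ 0]) simp
  fix x y :: rat
  assume "x \<in> range (\<lambda>i. of_int i / of_nat n)" "y \<in> range (\<lambda>i. of_int i / of_nat n)"
  then obtain i j where "x = of_int i / of_nat n" "y = of_int j / of_nat n" by blast
  then show "x - y \<in> range (\<lambda>i. of_int i / of_nat n)"
    by (intro range_eqI[of _ _ "i - j"]) (simp add: diff_divide_distrib)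
qed

text \<open>
  Any two Puiseux series have a common denominator, which makes \<open>PSF k\<close> a directed union.
\<close>
lemma laurent_series_mono:
  assumes "m > 0"
  shows "laurent_series k n \<subseteq> laurent_series k (n * m)"
proof -
  have "of_int i / of_nat n = (of_int (i * int m) / of_nat (n * m) :: rat)" for i
    using assms by simp
  then have "range (\<lambda>i. of_int i / of_nat n :: rat) \<subseteq> range (\<lambda>i. of_int i / of_nat (n * m))"
    by (metis (no_types, lifting) image_subsetI rangeI)
  then show ?thesis unfolding laurent_series_def by blast
qed

lemma PSF_iff: "f \<in> PSF k \<longleftrightarrow> (\<exists>n>0. f \<in> laurent_series k n)"
  by (auto simp: PSF_def Suc_le_eq)

lemma is_subfield_PSF:
  assumes "is_subfield k"
  shows "is_subfield (PSF k)"
proof -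
  have L: "is_subfield (laurent_series k n)" for n by (rule is_subfield_laurent_series[OF assms])
  note Lr = is_subringD[OF is_subfieldD(1)[OF L]]
  have I: "f \<in> PSF k" if "f \<in> laurent_series k n" "n > 0" for f n
    using that unfolding PSF_iff by blast
  have E: "\<exists>n>0. f \<in> laurent_series k n" if "f \<in> PSF k" for f
    using that unfolding PSF_iff by blast
  have "f - g \<in> PSF k \<and> f * g \<in> PSF k" if fg: "f \<in> PSF k" "g \<in> PSF k" for f g
  proof -
    obtain m n where "m > 0" "f \<in> laurent_series k m" "n > 0" "g \<in> laurent_series k n"
      using E fg by metis
    then have "f \<in> laurent_series k (m * n)" "g \<in> laurent_series k (m * n)" "m * n > 0"
      using laurent_series_mono[of n k m] laurent_series_mono[of m k n]
      by (auto simp: mult.commute)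
    then have "f - g \<in> laurent_series k (m * n)" "f * g \<in> laurent_series k (m * n)"
      by (blast intro: Lr(3) Lr(4))+
    then show ?thesis using I[OF _ \<open>m * n > 0\<close>] by blast
  qed
  moreover have "inverse f \<in> PSF k" if "f \<in> PSF k" for f
    using E[OF that] is_subfieldD(2)[OF L] I by metis
  ultimately show ?thesis
    using I[OF Lr(1), of 1] I[OF Lr(2), of 1] unfolding is_subfield_def is_subring_def by simp
qed

lemma PSF_subset_power_series: "PSF k \<subseteq> power_series k"
  by (auto simp: PSF_def laurent_series_def)

text \<open>
  Closeness in the valuation means equality of all coefficients up to a bound. In this form the
  approximation of sums, products and inverses is a computation with coefficients.
\<close>
lemma valuation_closure_iff:
  "f \<in> valuation_closure k K \<longleftrightarrow>
     f \<in> power_series k \<and> (\<forall>r. \<exists>g\<in>K. \<forall>q\<le>r. hcoeff f q = hcoeff g q)"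
proof -
  have "f = g \<or> hval (f - g) > r \<longleftrightarrow> (\<forall>q\<le>r. hcoeff f q = hcoeff g q)" for g r
  proof
    assume "f = g \<or> hval (f - g) > r"
    then show "\<forall>q\<le>r. hcoeff f q = hcoeff g q"
      using hval(2)[of "f - g"] by fastforce
  next
    assume *: "\<forall>q\<le>r. hcoeff f q = hcoeff g q"
    show "f = g \<or> hval (f - g) > r"
    proof (cases "f = g")
      case False
      then have "hcoeff f (hval (f - g)) \<noteq> hcoeff g (hval (f - g))"
        using hval(1)[of "f - g"] by simp
      then show ?thesis using * by force
    qed simp
  qed
  then show ?thesis by (auto simp: valuation_closure_def)
qed

lemma subset_valuation_closure: "K \<subseteq> power_series k \<Longrightarrow> K \<subseteq> valuation_closure k K"
  by (auto simp: valuation_closure_iff)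

text \<open>
  Multiplication and inversion are continuous for the valuation. An approximation of
  the arguments up to \<open>s\<close> gives one of the result up to \<open>s\<close> plus a constant: the constant is a
  lower bound \<open>l\<close> of the exponents of both factors in the case of a product, and \<open>- 2 * d\<close> for the
  inverse of a series of valuation \<open>d\<close>, because \<open>1/f - 1/g = (g - f) / (f * g)\<close>.
\<close>
lemma is_subfield_valuation_closure:
  fixes k :: "'a::field set"
  assumes k: "is_subfield k" and K: "is_subfield K" "K \<subseteq> power_series k"
  shows "is_subfield (valuation_closure k K)"
proof -
  let ?C = "valuation_closure k K"
  note pr = is_subringD[OF is_subfieldD(1)[OF is_subfield_power_series[OF k]]]
  note Kr = is_subringD[OF is_subfieldD(1)[OF K(1)]]
  have P: "f \<in> power_series k" if "f \<in> ?C" for f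
    using that unfolding valuation_closure_iff by blast
  have A: "\<exists>g\<in>K. \<forall>q\<le>r. hcoeff f q = hcoeff g q" if "f \<in> ?C" for f r
    using that unfolding valuation_closure_iff by blast
  have I: "f \<in> ?C"
    if "f \<in> power_series k" "\<And>r. \<exists>g\<in>K. \<forall>q\<le>r. hcoeff f q = hcoeff g q" for f
    using that unfolding valuation_closure_iff by blast
  have "f - g \<in> ?C" if fg: "f \<in> ?C" "g \<in> ?C" for f g
  proof (rule I)
    show "f - g \<in> power_series k" by (intro pr P fg)
    fix r
    obtain f' g' where "f' \<in> K" "g' \<in> K"
      "\<forall>q\<le>r. hcoeff f q = hcoeff f' q" "\<forall>q\<le>r. hcoeff g q = hcoeff g' q"
      using A fg by metis
    then show "\<exists>h\<in>K. \<forall>q\<le>r. hcoeff (f - g) q = hcoeff h q"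
      by (intro bexI[of _ "f' - g'"] Kr) auto
  qed
  moreover have "f * g \<in> ?C" if fg: "f \<in> ?C" "g \<in> ?C" for f g
  proof (rule I)
    show "f * g \<in> power_series k" by (intro pr P fg)
    fix r
    obtain a b where a: "\<And>q. q < a \<Longrightarrow> hcoeff f q = 0" and b: "\<And>q. q < b \<Longrightarrow> hcoeff g q = 0"
      by (metis hahn_lower_bound)
    define l where "l = min a b"
    \<comment> \<open>The bound \<open>s \<ge> l\<close> makes \<open>g'\<close> inherit the lower bound \<open>l\<close>; the summand 1
      turns the strict bound of \<open>vanish_times\<close> into one that includes \<open>r\<close>.\<close>
    define s where "s = max l (r - l + 1)"
    obtain f' g' where f': "f' \<in> K" "\<And>q. q \<le> s \<Longrightarrow> hcoeff f q = hcoeff f' q"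
      and g': "g' \<in> K" "\<And>q. q \<le> s \<Longrightarrow> hcoeff g q = hcoeff g' q"
      using A fg by metis
    have "hcoeff (f * g) q = hcoeff (f' * g') q" if "q \<le> r" for q
    proof -
      have q: "q < l + s" using that by (simp add: s_def max_def)
      have "f * g - f' * g' = f * (g - g') + g' * (f - f')" by (simp add: algebra_simps)
      moreover have "hcoeff (f * (g - g')) q = 0"
        by (rule vanish_times[OF _ _ q]) (use a g'(2) in \<open>auto simp: l_def\<close>)
      moreover have "hcoeff (g' * (f - f')) q = 0"
      proof (rule vanish_times[OF _ _ q])
        show "hcoeff g' p = 0" if "p < l" for p
        proof -
          have "p \<le> s" "p < b" using that by (auto simp: l_def s_def)
          then show ?thesis using b g'(2) by metis
        qed
        show "hcoeff (f - f') p = 0" if "p < s" for p using f'(2)[of p] that by simp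
      qed
      ultimately have "hcoeff (f * g - f' * g') q = 0" by simp
      then show ?thesis by simp
    qed
    then show "\<exists>h\<in>K. \<forall>q\<le>r. hcoeff (f * g) q = hcoeff h q"
      using Kr(4)[OF f'(1) g'(1)] by blast
  qed
  moreover have "inverse f \<in> ?C" if f: "f \<in> ?C" for f
  proof (cases "f = 0")
    case True
    then show ?thesis using f by simp
  next
    case False
    define d where "d = hval f"
    note fd = hval[OF False, folded d_def]
    show ?thesis
    proof (rule I)
      show "inverse f \<in> power_series k"
        by (intro is_subfieldD(2)[OF is_subfield_power_series[OF k]] P f)
      fix r
      \<comment> \<open>With \<open>s \<ge> d\<close> the approximation \<open>g\<close> has the same lowest exponent as \<open>f\<close>.\<close>
      define s where "s = max d (r + 2 * d + 1)"
      obtain g where g: "g \<in> K" "\<And>q. q \<le> s \<Longrightarrow> hcoeff f q = hcoeff g q"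
        using A f by metis
      have gd: "hcoeff g d \<noteq> 0" "\<And>q. q < d \<Longrightarrow> hcoeff g q = 0"
      proof -
        have "hcoeff g q = hcoeff f q" if "q \<le> d" for q
          using g(2)[of q] that by (simp add: s_def)
        then show "hcoeff g d \<noteq> 0" "\<And>q. q < d \<Longrightarrow> hcoeff g q = 0"
          using fd by simp_all
      qed
      then have "g \<noteq> 0" by auto
      have "hval g = d"
        using hval(1)[OF \<open>g \<noteq> 0\<close>] hval(2)[OF \<open>g \<noteq> 0\<close>, of d] gd(1) gd(2)[of "hval g"]
        by (cases "hval g" d rule: linorder_cases) simp_all
      have "hcoeff (inverse f) q = hcoeff (inverse g) q" if "q \<le> r" for q
      proof -
        have "inverse f - inverse g = (g - f) * (inverse f * inverse g)"
          using False \<open>g \<noteq> 0\<close> by (simp add: field_simps)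
        moreover have "hcoeff ((g - f) * (inverse f * inverse g)) q = 0"
        proof (rule vanish_times[of s _ "- d + - d"])
          show "hcoeff (g - f) p = 0" if "p < s" for p using g(2)[of p] that by simp
          show "hcoeff (inverse f * inverse g) p = 0" if "p < - d + - d" for p
            by (rule vanish_times[OF _ _ that])
              (use inverse_vanishes_below[OF False] inverse_vanishes_below[OF \<open>g \<noteq> 0\<close>]
                \<open>hval g = d\<close> in \<open>auto simp: d_def\<close>)
          show "q < s + (- d + - d)" using that by (simp add: s_def max_def)
        qed
        ultimately have "hcoeff (inverse f - inverse g) q = 0" by simp
        then show ?thesis by simp
      qed
      then show "\<exists>h\<in>K. \<forall>q\<le>r. hcoeff (inverse f) q = hcoeff h q"
        using is_subfieldD(2)[OF K(1) g(1)] by blast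
    qed
  qed
  moreover have "0 \<in> ?C" "1 \<in> ?C" using subset_valuation_closure[OF K(2)] Kr(1,2) by blast+
  ultimately show ?thesis by (intro is_subfieldI)
qed

section \<open>Integer parts are countable\<close>

text \<open>
  The exponents of a Puiseux series are bounded below and have a common denominator. Since the
  completion adds only series that agree with a Puiseux series up to exponent 0, the same
  finiteness holds there. This fails in the full power series field, and it is what keeps
  integer parts small.
\<close>
lemma finite_nonpos_exponents_PSF:
  assumes "f \<in> PSF k"
  shows "finite (supp f \<inter> {..0})"
proof -
  obtain n where n: "n > 0" "supp f \<subseteq> range (\<lambda>i. of_int i / of_nat n)"
    using assms unfolding PSF_iff laurent_series_def by blast
  obtain l where l: "\<And>q. q < l \<Longrightarrow> hcoeff f q = 0" by (metis hahn_lower_bound)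
  have "supp f \<inter> {..0} \<subseteq> (\<lambda>i. of_int i / of_nat n) ` {\<lfloor>l * of_nat n\<rfloor>..0}"
  proof
    fix q assume q: "q \<in> supp f \<inter> {..0}"
    then obtain i where i: "q = of_int i / of_nat n" using n(2) by blast
    have "l \<le> q" using q l by (force simp: supp_def)
    then have "l * of_nat n \<le> of_int i" using n(1) by (simp add: i field_simps)
    then have "\<lfloor>l * of_nat n\<rfloor> \<le> i" by linarith
    moreover have "i \<le> 0" using q n(1) by (simp add: i divide_le_0_iff)
    ultimately show "q \<in> (\<lambda>i. of_int i / of_nat n) ` {\<lfloor>l * of_nat n\<rfloor>..0}" using i by auto
  qed
  then show ?thesis by (rule finite_subset) auto
qed

lemma finite_nonpos_exponents_PSF_completion:
  assumes "f \<in> PSF_completion k"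
  shows "finite (supp f \<inter> {..0})"
proof -
  obtain g where "g \<in> PSF k" "\<forall>q\<le>0. hcoeff f q = hcoeff g q"
    using assms unfolding PSF_completion_def valuation_closure_iff by blast
  moreover from this have "supp f \<inter> {..0} = supp g \<inter> {..0}" by (auto simp: supp_def)
  ultimately show ?thesis using finite_nonpos_exponents_PSF by metis
qed

text \<open>
  The least positive element \<open>e\<close> satisfies \<open>e \<le> e * e\<close>, so \<open>e \<ge> 1\<close>, and a series with
  positive exponents only lies strictly between \<open>-1\<close> and \<open>1\<close>.
\<close>
lemma discrete_subring_no_infinitesimals:
  fixes I :: "'a::linordered_field hahn set"
  assumes I: "is_subring I" "discretely_ordered I"
    and f: "f \<in> I" "\<And>q. q \<le> 0 \<Longrightarrow> hcoeff f q = 0"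
  shows "f = 0"
proof (rule ccontr)
  assume "f \<noteq> 0"
  obtain e where e: "e \<in> I" "0 < e" "\<And>x. x \<in> I \<Longrightarrow> 0 < x \<Longrightarrow> e \<le> x"
    using I(2) unfolding discretely_ordered_def by blast
  have "e \<le> e * e" using e is_subringD(4)[OF I(1)] by simp
  then have "1 \<le> e" using e(2) by (simp add: mult_le_cancel_left1)
  have "\<bar>f\<bar> \<in> I" using f(1) is_subringD(5)[OF I(1)] by (simp add: abs_if)
  then have "1 \<le> \<bar>f\<bar>" using e(3)[of "\<bar>f\<bar>"] \<open>f \<noteq> 0\<close> \<open>1 \<le> e\<close> by simp
  moreover have "\<bar>f\<bar> < 1"
  proof -
    have 0: "hcoeff \<bar>f\<bar> q = 0" if "q \<le> 0" for q using f(2)[OF that] by (simp add: abs_if)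
    have "hcoeff (1 - \<bar>f\<bar>) 0 > 0 \<and> (\<forall>p<0. hcoeff (1 - \<bar>f\<bar>) p = 0)" by (auto simp: 0)
    then show ?thesis unfolding less_hahn_def hpos_iff by blast
  qed
  ultimately show False by simp
qed

text \<open>
  Two elements with the same coefficients at exponents \<open>\<le> 0\<close> differ by an infinitesimal, so they
  are equal. An element is therefore determined by a finite set of pairs
  of an exponent and a coefficient, and there are countably many such sets.
\<close>
lemma countable_discrete_subring:
  fixes I :: "'a::linordered_field hahn set"
  assumes I: "is_subring I" "discretely_ordered I"
    and k: "countable k" "I \<subseteq> power_series k"
    and fin: "\<And>f. f \<in> I \<Longrightarrow> finite (supp f \<inter> {..0})"
  shows "countable I"
proof -
  define graph where "graph f = (\<lambda>q. (q, hcoeff f q)) ` (supp f \<inter> {..0})" for f :: "'a hahn"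
  have "graph ` I \<subseteq> Fpow (UNIV \<times> k)"
    using fin k(2) by (auto simp: Fpow_def graph_def power_series_def)
  moreover have "countable (Fpow ((UNIV :: rat set) \<times> k))" by (intro countable_Fpow) (use k in auto)
  ultimately have "countable (graph ` I)" by (rule countable_subset)
  moreover have "inj_on graph I"
  proof (rule inj_onI)
    fix f g assume fg: "f \<in> I" "g \<in> I" "graph f = graph g"
    have mem: "(q, c) \<in> graph f \<longleftrightarrow> q \<le> 0 \<and> c \<noteq> 0 \<and> hcoeff f q = c" for f :: "'a hahn" and q c
      by (auto simp: graph_def supp_def)
    have "hcoeff f q = hcoeff g q" if "q \<le> 0" for q
      using mem[of q "hcoeff f q" f] mem[of q "hcoeff f q" g] mem[of q "hcoeff g q" g]
        mem[of q "hcoeff g q" f] fg(3) that by metis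
    then have "hcoeff (f - g) q = 0" if "q \<le> 0" for q using that by simp
    then have "f - g = 0"
      by (intro discrete_subring_no_infinitesimals[OF I] is_subringD(3)[OF I(1)] fg)
    then show "f = g" by simp
  qed
  ultimately show ?thesis by (rule countable_image_inj_on)
qed

text \<open>
  Cantor's diagonal argument: the coefficients 0 and 1 at the exponents \<open>0, 1, 2, \<dots>\<close> can be
  chosen freely.
\<close>
lemma uncountable_PSF:
  assumes "is_subring k"
  shows "uncountable (PSF k)"
proof
  assume "countable (PSF k)"
  then obtain F :: "nat \<Rightarrow> 'a hahn" where F: "PSF k \<subseteq> range F"
    by (metis countable_subset_image from_nat_into_surj image_subset_iff range_eqI subsetI uncountable_def)
  \<comment> \<open>At the exponent \<open>n\<close> the diagonal series differs from the \<open>n\<close>-th listed series; the floor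
    recovers the index \<open>n\<close> from the rational exponent.\<close>
  define c where "c q = (if q \<in> \<nat> \<and> hcoeff (F (nat \<lfloor>q\<rfloor>)) q = 0 then 1 else 0 :: 'a)" for q
  have wo: "wfp_on (\<nat> :: rat set) (<)"
  proof (rule wo_if_no_descent)
    fix s :: "nat \<Rightarrow> rat"
    assume s: "\<And>n. s n \<in> \<nat>" "\<And>n. s (Suc n) < s n"
    then have "\<forall>n. \<exists>m. s n = of_nat m" by (metis Nats_cases)
    then obtain t :: "nat \<Rightarrow> nat" where "\<And>n. s n = of_nat (t n)" by metis
    with s(2) have dec: "t (Suc n) < t n" for n by simp
    have "t n + n \<le> t 0" for n
    proof (induction n)
      case (Suc n)
      then show ?case using dec[of n] by linarith
    qed simp
    from this[of "Suc (t 0)"] show False by simp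
  qed
  define g where "g = Abs_hahn c"
  have g: "hcoeff g = c"
    unfolding g_def by (rule hcoeff_Abs[OF _ wo]) (auto simp: c_def)
  have "g \<in> laurent_series k 1"
    using is_subringD(1,2)[OF assms]
    by (auto simp: laurent_series_def power_series_def supp_def g c_def Nats_altdef1 split: if_splits)
  then have "g \<in> PSF k" by (auto simp: PSF_def)
  then obtain n where "g = F n" using F by blast
  then have "hcoeff (F n) (of_nat n) = c (of_nat n)" using g by simp
  then show False by (simp add: c_def split: if_splits)
qed

section \<open>Transcendence bases\<close>

definition mono_val :: "('a::field \<Rightarrow>\<^sub>0 nat) \<Rightarrow> 'a" where
  "mono_val m = (\<Prod>b\<in>Poly_Mapping.keys m. b ^ Poly_Mapping.lookup m b)"

lemma eval_self_eq:
  "eval_self p = (\<Sum>m\<in>Poly_Mapping.keys p. Poly_Mapping.lookup p m * mono_val m)"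
  by (simp add: eval_self_def mono_val_def)

text \<open>
  The coefficient of \<open>x ^ i\<close> when \<open>p\<close> is read as a univariate polynomial in \<open>x\<close> over the
  polynomials in the other variables.
\<close>
definition var_coeff :: "'a \<Rightarrow> nat \<Rightarrow> (('a \<Rightarrow>\<^sub>0 nat) \<Rightarrow>\<^sub>0 'a::field) \<Rightarrow> ('a \<Rightarrow>\<^sub>0 nat) \<Rightarrow>\<^sub>0 'a" where
  "var_coeff x i p = Abs_poly_mapping
     (\<lambda>m. if Poly_Mapping.lookup m x = 0
          then Poly_Mapping.lookup p (m + Poly_Mapping.single x i) else 0)"

lemma lookup_var_coeff:
  "Poly_Mapping.lookup (var_coeff x i p) m =
     (if Poly_Mapping.lookup m x = 0
      then Poly_Mapping.lookup p (m + Poly_Mapping.single x i) else 0)"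
proof -
  let ?f = "\<lambda>m. if Poly_Mapping.lookup m x = 0
    then Poly_Mapping.lookup p (m + Poly_Mapping.single x i) else 0"
  have "finite {m. ?f m \<noteq> 0}"
  proof (rule finite_subset)
    show "finite ((\<lambda>m. m + Poly_Mapping.single x i) -` Poly_Mapping.keys p)"
      by (rule finite_vimageI) (auto simp: inj_def)
  qed (auto simp: in_keys_iff)
  then show ?thesis unfolding var_coeff_def by (subst lookup_Abs_poly_mapping) auto
qed

lemma mono_val_add_single:
  "mono_val (m + Poly_Mapping.single x i) = mono_val m * x ^ i"
proof -
  let ?S = "insert x (Poly_Mapping.keys m)"
  have eq: "mono_val n = (\<Prod>b\<in>?S. b ^ Poly_Mapping.lookup n b)" if "Poly_Mapping.keys n \<subseteq> ?S" for n
    unfolding mono_val_def using that by (intro prod.mono_neutral_left) (auto simp: in_keys_iff)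
  have "Poly_Mapping.keys (m + Poly_Mapping.single x i) \<subseteq> ?S"
    using Poly_Mapping.keys_add[of m "Poly_Mapping.single x i"] by (auto split: if_splits)
  from eq[OF this] have "mono_val (m + Poly_Mapping.single x i) =
      (\<Prod>b\<in>?S. b ^ Poly_Mapping.lookup m b) *
      (\<Prod>b\<in>?S. b ^ Poly_Mapping.lookup (Poly_Mapping.single x i) b)"
    by (simp only: lookup_add power_add prod.distrib)
  also have "(\<Prod>b\<in>?S. b ^ Poly_Mapping.lookup m b) = mono_val m" by (rule eq[symmetric]) auto
  also have "(\<Prod>b\<in>?S. b ^ Poly_Mapping.lookup (Poly_Mapping.single x i) b) =
      (\<Prod>b\<in>{x}. b ^ Poly_Mapping.lookup (Poly_Mapping.single x i) b)"
    by (rule prod.mono_neutral_right) (auto simp: lookup_single when_def)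
  finally show ?thesis by simp
qed

lemma eval_self_expand:
  "eval_self p = (\<Sum>i\<in>(\<lambda>m. Poly_Mapping.lookup m x) ` Poly_Mapping.keys p.
     eval_self (var_coeff x i p) * x ^ i)"
proof -
  have "(\<Sum>m\<in>{m \<in> Poly_Mapping.keys p. Poly_Mapping.lookup m x = i}.
      Poly_Mapping.lookup p m * mono_val m) = eval_self (var_coeff x i p) * x ^ i" for i
  proof -
    have sub: "m - Poly_Mapping.single x i + Poly_Mapping.single x i = m"
      if "Poly_Mapping.lookup m x = i" for m
      using that by (intro poly_mapping_eqI) (auto simp: lookup_add lookup_minus lookup_single when_def)
    show ?thesis
      unfolding eval_self_eq sum_distrib_right
      by (rule sum.reindex_bij_witness[of _ "\<lambda>m. m + Poly_Mapping.single x i"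
            "\<lambda>m. m - Poly_Mapping.single x i"])
        (auto simp: in_keys_iff lookup_var_coeff lookup_add lookup_minus sub
          mono_val_add_single[symmetric] mult.assoc split: if_splits)
  qed
  then show ?thesis
    unfolding eval_self_eq[of p]
    by (subst sum.image_gen[OF finite_keys, of _ _ "\<lambda>m. Poly_Mapping.lookup m x"]) simp
qed

lemma eval_self_in_hull:
  assumes "\<And>m. m \<in> Poly_Mapping.keys p \<Longrightarrow> Poly_Mapping.lookup p m \<in> F \<and> Poly_Mapping.keys m \<subseteq> B"
  shows "eval_self p \<in> is_subfield hull (F \<union> B)"
proof -
  note R = is_subfieldD(1)[OF is_subfield_hull]
  have inc: "x \<in> is_subfield hull (F \<union> B)" if "x \<in> F \<union> B" for x
    using that by (rule hull_inc)
  show ?thesis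
    unfolding eval_self_def
    by (intro is_subring_sum[OF R] is_subringD(4)[OF R] is_subring_prod[OF R]
        is_subring_power[OF R] inc) (use assms in auto)
qed

text \<open>
  A polynomial relation that involves \<open>x\<close>, sorted by powers of \<open>x\<close>, is a univariate
  polynomial over the field generated by \<open>F\<close> and \<open>B\<close> with root \<open>x\<close>. It does not vanish
  identically: some coefficient is a nonzero polynomial in variables from \<open>B\<close>, and its value is
  nonzero because \<open>B\<close> is independent.
\<close>
lemma algebraic_if_dependent:
  assumes B: "algebraically_independent F B"
    and x: "\<not> algebraically_independent F (insert x B)"
  shows "algebraic_over (is_subfield hull (F \<union> B)) x"
proof -
  obtain p where p: "\<And>m. m \<in> Poly_Mapping.keys p \<Longrightarrow>
      Poly_Mapping.lookup p m \<in> F \<and> Poly_Mapping.keys m \<subseteq> insert x B"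
    and p0: "eval_self p = 0" "p \<noteq> 0"
    using x unfolding algebraically_independent_def by blast
  let ?q = "\<lambda>i. var_coeff x i p"
  let ?J = "(\<lambda>m. Poly_Mapping.lookup m x) ` Poly_Mapping.keys p"
  have q: "Poly_Mapping.lookup (?q i) m \<in> F \<and> Poly_Mapping.keys m \<subseteq> B"
    if "m \<in> Poly_Mapping.keys (?q i)" for i m
  proof -
    have m: "Poly_Mapping.lookup m x = 0" "m + Poly_Mapping.single x i \<in> Poly_Mapping.keys p"
      "Poly_Mapping.lookup (?q i) m = Poly_Mapping.lookup p (m + Poly_Mapping.single x i)"
      using that by (auto simp: in_keys_iff lookup_var_coeff split: if_splits)
    have "Poly_Mapping.keys m \<subseteq> Poly_Mapping.keys (m + Poly_Mapping.single x i)"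
      by (auto simp: in_keys_iff lookup_add)
    with p[OF m(2)] m(1,3) show ?thesis by (auto simp: in_keys_iff)
  qed
  define P where "P = (\<Sum>i\<in>?J. monom (eval_self (?q i)) i)"
  have coeff: "poly.coeff P i = (if i \<in> ?J then eval_self (?q i) else 0)" for i
    by (simp add: P_def coeff_sum)
  have "poly P x = 0"
    using p0(1) eval_self_expand[of p x] by (simp add: P_def poly_sum poly_monom)
  moreover have "poly.coeff P i \<in> is_subfield hull (F \<union> B)" for i
  proof -
    have "0 \<in> is_subfield hull (F \<union> B)"
      by (rule is_subringD(1)[OF is_subfieldD(1)[OF is_subfield_hull]])
    then show ?thesis unfolding coeff using eval_self_in_hull[OF q] by simp
  qed
  moreover have "P \<noteq> 0"
  proof -
    obtain m where m: "m \<in> Poly_Mapping.keys p"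
      using p0(2) by (auto simp: poly_mapping_eq_iff in_keys_iff fun_eq_iff)
    define i where "i = Poly_Mapping.lookup m x"
    have "m - Poly_Mapping.single x i + Poly_Mapping.single x i = m"
      by (intro poly_mapping_eqI) (auto simp: lookup_add lookup_minus lookup_single when_def i_def)
    then have "Poly_Mapping.lookup (?q i) (m - Poly_Mapping.single x i) \<noteq> 0"
      using m by (simp add: lookup_var_coeff lookup_minus i_def in_keys_iff)
    then have "?q i \<noteq> 0" by auto
    then have "eval_self (?q i) \<noteq> 0"
      using B q unfolding algebraically_independent_def by blast
    moreover have "i \<in> ?J" using m i_def by blast
    ultimately show ?thesis using coeff[of i] by auto
  qed
  ultimately show ?thesis unfolding algebraic_over_def by blast
qed

lemma algebraically_independent_empty: "algebraically_independent F {}"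
  unfolding algebraically_independent_def
proof (intro allI impI, elim conjE)
  fix p :: "('a \<Rightarrow>\<^sub>0 nat) \<Rightarrow>\<^sub>0 'a"
  assume p: "\<forall>m\<in>Poly_Mapping.keys p. Poly_Mapping.lookup p m \<in> F \<and> Poly_Mapping.keys m \<subseteq> {}"
    and ev: "eval_self p = 0"
  have "Poly_Mapping.keys p \<subseteq> {0}" using p by auto
  then have "eval_self p = (\<Sum>m\<in>{0}. Poly_Mapping.lookup p m * mono_val m)"
    unfolding eval_self_eq by (intro sum.mono_neutral_left) (auto simp: in_keys_iff)
  with ev have "Poly_Mapping.lookup p 0 = 0" by (simp add: mono_val_def)
  then have "Poly_Mapping.lookup p m = 0" for m
    using \<open>Poly_Mapping.keys p \<subseteq> {0}\<close> by (cases "m = 0") (auto simp: in_keys_iff)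
  then show "p = 0" by (intro poly_mapping_eqI) simp
qed

text \<open>
  Zorn's lemma applies because one polynomial involves finitely many variables, so a relation
  in the union of a chain already holds in a member. For a maximal
  independent \<open>B\<close>, every element of \<open>L\<close> is algebraic over the field generated by \<open>F\<close> and
  \<open>B\<close>, by \<open>algebraic_if_dependent\<close>.
\<close>
lemma transcendence_basis_exists:
  fixes F L :: "'a::field set"
  shows "\<exists>B. transcendence_basis F L B"
proof -
  let ?A = "{B. B \<subseteq> L \<and> algebraically_independent F B}"
  have "\<exists>B\<in>?A. \<forall>C\<in>?A. B \<subseteq> C \<longrightarrow> C = B"
  proof (rule subset_Zorn_nonempty)
    show "?A \<noteq> {}" using algebraically_independent_empty by blast
    fix \<C> assume \<C>: "\<C> \<noteq> {}" "subset.chain ?A \<C>"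
    have "algebraically_independent F (\<Union>\<C>)"
      unfolding algebraically_independent_def
    proof (intro allI impI, elim conjE)
      fix p :: "('a \<Rightarrow>\<^sub>0 nat) \<Rightarrow>\<^sub>0 'a"
      assume p: "\<forall>m\<in>Poly_Mapping.keys p. Poly_Mapping.lookup p m \<in> F \<and> Poly_Mapping.keys m \<subseteq> \<Union>\<C>"
        and ev: "eval_self p = 0"
      have "finite (\<Union>m\<in>Poly_Mapping.keys p. Poly_Mapping.keys m)" by simp
      moreover have "(\<Union>m\<in>Poly_Mapping.keys p. Poly_Mapping.keys m) \<subseteq> \<Union>\<C>" using p by blast
      ultimately obtain C where C: "C \<in> \<C>" "(\<Union>m\<in>Poly_Mapping.keys p. Poly_Mapping.keys m) \<subseteq> C"
        by (rule finite_subset_Union_chain[OF _ _ \<C>])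
      then have "algebraically_independent F C" using \<C>(2) by (auto simp: subset_chain_def)
      moreover have "\<forall>m\<in>Poly_Mapping.keys p. Poly_Mapping.lookup p m \<in> F \<and> Poly_Mapping.keys m \<subseteq> C"
        using p C(2) by blast
      ultimately show "p = 0" using ev unfolding algebraically_independent_def by blast
    qed
    then show "\<Union>\<C> \<in> ?A" using \<C>(2) by (auto simp: subset_chain_def)
  qed
  then obtain B where B: "B \<in> ?A" and max: "\<forall>C\<in>?A. B \<subseteq> C \<longrightarrow> C = B" by (rule bexE)
  have "algebraic_over (is_subfield hull (F \<union> B)) x" if "x \<in> L" for x
  proof (cases "x \<in> B")
    case True
    then have x: "x \<in> is_subfield hull (F \<union> B)" by (intro hull_inc) simp
    note R = is_subringD[OF is_subfieldD(1)[OF is_subfield_hull]]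
    have "poly.coeff [:- x, 1:] i \<in> is_subfield hull (F \<union> B)" for i
      using x R by (auto simp: coeff_pCons split: nat.split)
    then show ?thesis
      unfolding algebraic_over_def by (intro exI[of _ "[:- x, 1:]"]) auto
  next
    case False
    then have "\<not> algebraically_independent F (insert x B)"
      using max[rule_format, of "insert x B"] B that by auto
    then show ?thesis using B by (intro algebraic_if_dependent) auto
  qed
  then have "transcendence_basis F L B" using B by (simp add: transcendence_basis_def)
  then show ?thesis by (rule exI)
qed

text \<open>
  Over a countable field, a countable transcendence basis would generate a countable field, and
  its algebraic elements are too few to exhaust \<open>L\<close>.
\<close>
lemma uncountable_trdeg_if_countable_base:
  assumes "countable F" "uncountable L"
  shows "uncountable_trdeg F L"
proof -
  have "uncountable B" if "transcendence_basis F L B" for B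
  proof
    assume "countable B"
    then have "countable {x. algebraic_over (is_subfield hull (F \<union> B)) x}"
      using assms(1) by (intro countable_algebraic_over countable_subfield_hull) auto
    moreover have "L \<subseteq> {x. algebraic_over (is_subfield hull (F \<union> B)) x}"
      using that by (auto simp: transcendence_basis_def)
    ultimately show False using assms(2) countable_subset by blast
  qed
  then show ?thesis using transcendence_basis_exists unfolding uncountable_trdeg_def by blast
qed

section \<open>Quotient fields of integer parts\<close>

text \<open>
  The Puiseux series field and its completion enter the argument only as uncountable fields of
  power series over a countable field whose members have finitely many exponents \<open>\<le> 0\<close>.
\<close>
lemma integer_part_small:
  fixes K :: "'a::linordered_field hahn set"
  assumes K: "is_subfield K" "K \<subseteq> power_series k" "uncountable K" and k: "countable k"
    and fin: "\<And>f. f \<in> K \<Longrightarrow> finite (supp f \<inter> {..0})"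
    and I: "integer_part K I"
  shows "is_subfield (Quot I) \<and> Quot I \<subset> K \<and> countable (Quot I) \<and> uncountable_trdeg (Quot I) K"
proof -
  have I': "I \<subseteq> K" "is_subring I" "discretely_ordered I"
    using I by (auto simp: integer_part_def)
  have "countable I"
    by (rule countable_discrete_subring[OF I'(2,3) k]) (use I' K fin in auto)
  then have c: "countable (Quot I)" by (rule countable_Quot)
  moreover have "Quot I \<subseteq> K" by (rule Quot_subset[OF K(1) I'(1)])
  ultimately show ?thesis
    using is_subfield_Quot[OF I'(2)] uncountable_trdeg_if_countable_base[OF c K(3)] K(3) by auto
qed

theorem theorem5:
  shows
   "(\<forall>I. integer_part (PSF Qrc) I \<longrightarrow>
       is_subfield (Quot I) \<and> Quot I \<subset> PSF Qrc \<and> countable (Quot I) \<and>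
       uncountable_trdeg (Quot I) (PSF Qrc)) \<and>
    (\<forall>I. integer_part (PSF_completion Qrc) I \<longrightarrow>
       is_subfield (Quot I) \<and> Quot I \<subset> PSF_completion Qrc \<and> countable (Quot I) \<and>
       uncountable_trdeg (Quot I) (PSF_completion Qrc))"
proof (intro conjI allI impI)
  note PSF = is_subfield_PSF[OF is_subfield_Qrc] PSF_subset_power_series
    uncountable_PSF[OF is_subfieldD(1)[OF is_subfield_Qrc]]
  have C: "is_subfield (PSF_completion Qrc)"
    unfolding PSF_completion_def
    by (rule is_subfield_valuation_closure[OF is_subfield_Qrc PSF(1,2)])
  have C_series: "PSF_completion Qrc \<subseteq> power_series Qrc"
    by (auto simp: PSF_completion_def valuation_closure_def)
  have "PSF Qrc \<subseteq> PSF_completion Qrc"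
    unfolding PSF_completion_def by (rule subset_valuation_closure[OF PSF(2)])
  then have C_unc: "uncountable (PSF_completion Qrc)" using PSF(3) countable_subset by blast
  fix I
  show "is_subfield (Quot I)" "Quot I \<subset> PSF Qrc" "countable (Quot I)"
    "uncountable_trdeg (Quot I) (PSF Qrc)" if I: "integer_part (PSF Qrc) I"
    using integer_part_small[OF PSF countable_Qrc _ I] finite_nonpos_exponents_PSF[of _ Qrc]
    by simp_all
  show "is_subfield (Quot I)" "Quot I \<subset> PSF_completion Qrc" "countable (Quot I)"
    "uncountable_trdeg (Quot I) (PSF_completion Qrc)" if I: "integer_part (PSF_completion Qrc) I"
    using integer_part_small[OF C C_series C_unc countable_Qrc _ I]
      finite_nonpos_exponents_PSF_completion[of _ Qrc]
    by simp_all
qed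

end
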